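(* There does not exist a universal operator for the class of non-completely-continuous operators. That is, there do not exist Banach spaces $\mathfrak{X},\mathcal{Z}$ and an operator $S:\mathfrak{X}\to\mathcal{Z}$ that is not completely continuous such that, for all Banach spaces $V,W$ and every operator $U: V\to W$ that is not completely continuous, there exist operators $A:\mathfrak{X}\to V$ and $B: W\to\mathcal{Z}$ with $BUA=S$.
   Context: Scalars are real. "Operator" means bounded linear operator between Banach spaces. An operator is completely continuous if it carries weakly convergent sequences into norm convergent sequences. An operator $S$ factors through an operator $U$ if there exist operators $A$ and $B$ with $BUA=S$. An operator $S$ belonging to a class $\mathfrak{C}$ of operators is universal for $\mathfrak{C}$ if $S$ factors through every $U$ in $\mathfrak{C}$. *)

theory Defs
  imports "HOL-Analysis.Analysis" "HOL-Algebra.Module"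
begin

text \<open>
  Operators between arbitrary Banach spaces have to be quantified over inside a formula, so Banach
  spaces are explicit structures with a carrier inside a type, extending the modules of
  HOL-Algebra by a norm. As usual for modules in HOL-Algebra, the ring multiplication and unit of
  the record are unused. The carrier type plays the role of a universe.
\<close>

record 'u normed_structure = "(real, 'u) module" +
  vnorm :: "'u \<Rightarrow> real"

definition real_field :: "real ring"
  where "real_field = \<lparr>carrier = UNIV, mult = (*), one = 1, zero = 0, add = (+)\<rparr>"

locale normed_vector_space = Module.module real_field X for X (structure) +
  assumes vnorm_nonneg: "x \<in> carrier X \<Longrightarrow> 0 \<le> vnorm X x"
    and vnorm_eq_0: "x \<in> carrier X \<Longrightarrow> vnorm X x = 0 \<longleftrightarrow> x = \<zero>"
    and vnorm_triangle: "x \<in> carrier X \<Longrightarrow> y \<in> carrier X \<Longrightarrow> vnorm X (x \<oplus> y) \<le> vnorm X x + vnorm X y"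
    and vnorm_smult: "x \<in> carrier X \<Longrightarrow> vnorm X (a \<odot> x) = \<bar>a\<bar> * vnorm X x"

text \<open>
  The value outside the carrier is a dummy; \<^term>\<open>Metric_space\<close> requires nonnegativity and
  symmetry there as well.
\<close>

definition vdist :: "('u, 'm) normed_structure_scheme \<Rightarrow> 'u \<Rightarrow> 'u \<Rightarrow> real"
  where "vdist X x y =
    (if x \<in> carrier X \<and> y \<in> carrier X then vnorm X (x \<ominus>\<^bsub>X\<^esub> y) else 0)"

locale banach_space = normed_vector_space +
  assumes complete: "Metric_space.mcomplete (carrier X) (vdist X)"

definition norm_topology :: "('u, 'm) normed_structure_scheme \<Rightarrow> 'u topology"
  where "norm_topology X = Metric_space.mtopology (carrier X) (vdist X)"

text \<open>Operators are functions of which only the values on the carrier of the domain matter.\<close>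

definition operator ::
  "('u, 'm) normed_structure_scheme \<Rightarrow> ('v, 'n) normed_structure_scheme \<Rightarrow> ('u \<Rightarrow> 'v) \<Rightarrow> bool"
  where "operator X Y T \<longleftrightarrow>
    T \<in> carrier X \<rightarrow> carrier Y \<and>
    (\<forall>x \<in> carrier X. \<forall>y \<in> carrier X. T (x \<oplus>\<^bsub>X\<^esub> y) = T x \<oplus>\<^bsub>Y\<^esub> T y) \<and>
    (\<forall>a. \<forall>x \<in> carrier X. T (a \<odot>\<^bsub>X\<^esub> x) = a \<odot>\<^bsub>Y\<^esub> T x) \<and>
    (\<exists>K. \<forall>x \<in> carrier X. vnorm Y (T x) \<le> K * vnorm X x)"

definition type_space :: "'a::real_normed_vector normed_structure"
  where "type_space =
    \<lparr>carrier = UNIV, mult = undefined, one = undefined, zero = 0, add = (+),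
     smult = scaleR, vnorm = norm\<rparr>"

definition weakly_converges ::
  "('u, 'm) normed_structure_scheme \<Rightarrow> (nat \<Rightarrow> 'u) \<Rightarrow> 'u \<Rightarrow> bool"
  where "weakly_converges X s l \<longleftrightarrow>
    range s \<subseteq> carrier X \<and> l \<in> carrier X \<and>
    (\<forall>\<phi>. operator X (type_space :: real normed_structure) \<phi> \<longrightarrow> (\<lambda>n. \<phi> (s n)) \<longlonglongrightarrow> \<phi> l)"

definition completely_continuous ::
  "('u, 'm) normed_structure_scheme \<Rightarrow> ('v, 'n) normed_structure_scheme \<Rightarrow> ('u \<Rightarrow> 'v) \<Rightarrow> bool"
  where "completely_continuous X Y T \<longleftrightarrow>
    operator X Y T \<and>
    (\<forall>s. (\<exists>l. weakly_converges X s l) \<longrightarrow>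
         (\<exists>m. limitin (norm_topology Y) (\<lambda>n. T (s n)) m sequentially))"

definition factors_through ::
  "'u normed_structure \<Rightarrow> 'u normed_structure \<Rightarrow> ('u \<Rightarrow> 'u) \<Rightarrow>
   'u normed_structure \<Rightarrow> 'u normed_structure \<Rightarrow> ('u \<Rightarrow> 'u) \<Rightarrow> bool"
  where "factors_through X Z S V W U \<longleftrightarrow>
    (\<exists>A B. operator X V A \<and> operator W Z B \<and> (\<forall>x \<in> carrier X. B (U (A x)) = S x))"

text \<open>
  A class of operators in the universe \<^typ>\<open>'u\<close> is a predicate on triples consisting of domain,
  codomain and operator.
\<close>

type_synonym 'u operator_class =
  "'u normed_structure \<Rightarrow> 'u normed_structure \<Rightarrow> ('u \<Rightarrow> 'u) \<Rightarrow> bool"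

definition universal_for ::
  "'u operator_class \<Rightarrow> 'u normed_structure \<Rightarrow> 'u normed_structure \<Rightarrow> ('u \<Rightarrow> 'u) \<Rightarrow> bool"
  where "universal_for C X Z S \<longleftrightarrow>
    C X Z S \<and> (\<forall>V W U. C V W U \<longrightarrow> factors_through X Z S V W U)"

definition non_completely_continuous :: "'u operator_class"
  where "non_completely_continuous X Z S \<longleftrightarrow>
    banach_space X \<and> banach_space Z \<and> operator X Z S \<and> \<not> completely_continuous X Z S"

lemma cring_real_field: "cring real_field"
proof (rule cringI)
  show "abelian_group real_field"
    by (rule abelian_groupI)
      (auto simp: real_field_def algebra_simps intro: exI[of _ "- x" for x :: real])
  show "comm_monoid real_field"
    by unfold_locales (auto simp: real_field_def)
qed (auto simp: real_field_def algebra_simps)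

lemma ominus_real_field: "\<ominus>\<^bsub>real_field\<^esub> a = - a"
proof -
  interpret cring real_field by (rule cring_real_field)
  show ?thesis by (rule minus_equality) (auto simp: real_field_def)
qed

lemma (in normed_vector_space) Metric_space_vdist: "Metric_space (carrier X) (vdist X)"
proof
  fix x y
  show "0 \<le> vdist X x y"
    by (simp add: vdist_def vnorm_nonneg)
  show "vdist X x y = vdist X y x"
  proof (cases "x \<in> carrier X \<and> y \<in> carrier X")
    case True
    have "(- 1) \<odot> (y \<ominus> x) = \<ominus> (y \<ominus> x)"
      using True smult_l_minus[of "1" "y \<ominus> x"] smult_one[of "y \<ominus> x"]
      by (simp add: real_field_def ominus_real_field[unfolded real_field_def])
    also have "\<dots> = x \<ominus> y"
      using True by (simp add: a_minus_def M.minus_add M.a_comm)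
    finally show ?thesis
      using True vnorm_smult[of "y \<ominus> x" "- 1"] by (simp add: vdist_def)
  qed (auto simp: vdist_def)
next
  fix x y assume "x \<in> carrier X" "y \<in> carrier X"
  then show "vdist X x y = 0 \<longleftrightarrow> x = y"
    by (metis vdist_def vnorm_eq_0 M.minus_closed M.minus_equality M.minus_minus M.r_neg
        M.a_inv_closed a_minus_def)
next
  fix x y z assume xyz: "x \<in> carrier X" "y \<in> carrier X" "z \<in> carrier X"
  then have "x \<ominus> z = (x \<ominus> y) \<oplus> (y \<ominus> z)"
    by (simp add: a_minus_def M.a_assoc M.r_neg1 M.r_neg2)
  then show "vdist X x z \<le> vdist X x y + vdist X y z"
    using xyz vnorm_triangle[of "x \<ominus> y" "y \<ominus> z"] by (simp add: vdist_def)
qed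

text \<open>Consistency with the corresponding type-class notions.\<close>

lemma type_space_simps [simp]:
  "carrier type_space = UNIV" "x \<oplus>\<^bsub>type_space\<^esub> y = x + y" "\<zero>\<^bsub>type_space\<^esub> = 0"
  "a \<odot>\<^bsub>type_space\<^esub> x = a *\<^sub>R x" "vnorm type_space x = norm x"
  by (simp_all add: type_space_def)

lemma abelian_group_type_space: "abelian_group (type_space :: 'a::real_normed_vector normed_structure)"
proof (rule abelian_groupI)
  fix x :: 'a
  show "\<exists>y \<in> carrier type_space. y \<oplus>\<^bsub>type_space\<^esub> x = \<zero>\<^bsub>type_space\<^esub>"
    by (intro bexI[of _ "- x"]) auto
qed (auto simp: algebra_simps)

lemma vdist_type_space [simp]: "vdist (type_space :: 'a::real_normed_vector normed_structure) = dist"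
proof (intro ext)
  interpret abelian_group "type_space :: 'a normed_structure" by (rule abelian_group_type_space)
  fix x y :: 'a
  have "\<ominus>\<^bsub>type_space\<^esub> y = - y"
    by (intro minus_equality) auto
  then show "vdist type_space x y = dist x y"
    by (simp add: vdist_def a_minus_def dist_norm)
qed

lemma normed_vector_space_type_space:
  "normed_vector_space (type_space :: 'a::real_normed_vector normed_structure)"
proof -
  have "Module.module real_field (type_space :: 'a normed_structure)"
    by (rule moduleI[OF cring_real_field abelian_group_type_space])
      (auto simp: real_field_def algebra_simps)
  then show ?thesis
    by (intro normed_vector_space.intro normed_vector_space_axioms.intro)
      (auto simp: norm_triangle_ineq)
qed

lemma banach_space_type_space: "banach_space (type_space :: 'a::banach normed_structure)"
proof -
  have "Metric_space.mcomplete (UNIV :: 'a set) dist"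
    unfolding Met_TC.mcomplete_def by (auto simp: Cauchy_convergent_iff convergent_def)
  then show ?thesis
    by (intro banach_space.intro banach_space_axioms.intro normed_vector_space_type_space) simp
qed

lemma norm_topology_type_space:
  "norm_topology (type_space :: 'a::real_normed_vector normed_structure) = euclidean"
  by (simp add: norm_topology_def)

lemma limitin_norm_topology:
  assumes "normed_vector_space X" "range s \<subseteq> carrier X" "l \<in> carrier X"
  shows "limitin (norm_topology X) s l sequentially \<longleftrightarrow>
    (\<lambda>n. vnorm X (s n \<ominus>\<^bsub>X\<^esub> l)) \<longlonglongrightarrow> 0"
proof -
  interpret Metric_space "carrier X" "vdist X"
    by (rule normed_vector_space.Metric_space_vdist) fact
  have "vdist X (s n) l = vnorm X (s n \<ominus>\<^bsub>X\<^esub> l)" for n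
    using assms by (auto simp: vdist_def)
  then show ?thesis
    using assms unfolding norm_topology_def
    by (auto simp: limitin_metric_dist_null image_subset_iff)
qed

lemma operator_type_space: "operator type_space type_space T \<longleftrightarrow> bounded_linear T"
  unfolding operator_def
  by (auto simp: bounded_linear_def bounded_linear_axioms_def linear_iff mult.commute)

lemma completely_continuous_type_space:
  "completely_continuous type_space type_space T \<longleftrightarrow>
    bounded_linear T \<and>
    (\<forall>s l. (\<forall>\<phi>. bounded_linear \<phi> \<longrightarrow> (\<lambda>n. \<phi> (s n) :: real) \<longlonglongrightarrow> \<phi> l) \<longrightarrow>
      convergent (\<lambda>n. T (s n)))"
  by (auto simp: completely_continuous_def weakly_converges_def operator_type_space
    norm_topology_type_space convergent_def)

end

theory Submission
  imports Defs
begin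

text \<open>
  Let \<open>S\<close> be an operator that is not completely continuous, and let \<open>x n\<close> be a weakly null
  sequence with \<open>S (x n)\<close> bounded away from 0. A non-completely-continuous operator through which
  \<open>S\<close> does not factor is constructed from \<open>x\<close>: it is the formal identity from a Banach space
  \<open>V\<close> of real sequences into \<open>c\<^sub>0\<close>. The norm of \<open>V\<close> is the supremum, over
  the members \<open>E\<close> of a family \<open>H\<close> of finite sets, of the \<open>l\<^sub>1\<close> norm over
  \<open>E\<close>, as in the spaces of Schreier.

  For \<open>c > 0\<close> consider the tree \<open>G c\<close> of all finite lists \<open>i 1 < \<dots> < i r\<close>
  with \<open>\<parallel>\<Sum> a j * x (i j)\<parallel> \<ge> c * \<Sum> a j\<close> for all nonnegative
  coefficients. It has no infinite branch, because by the Hahn-Banach theorem a functional would stay above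
  \<open>c\<close> along the branch. The family \<open>H\<close> has to satisfy two conflicting demands: it must be so
  small that the unit vectors are weakly null in \<open>V\<close>, and so large that it is not mapped into any
  \<open>G c\<close> by an injection of indices. Let \<open>H\<close> consist of the lists \<open>n\<^sub>0 <
  n\<^sub>1 < \<dots> < n\<^sub>r\<close> such that \<open>n\<^sub>1, \<dots>, n\<^sub>r\<close> arises from a list in
  \<open>G (1 / (N + 1))\<close>, for some \<open>N \<le> n\<^sub>0\<close>, by moving its entries to the right.

  The unit vectors are weakly null in \<open>V\<close> by a form of Ptak's combinatorial lemma, proved by induction
  over the well-founded trees \<open>G c\<close> (\<open>negligible_spreads\<close>,
  \<open>negligible_diagonal_step\<close>, \<open>weakly_null_unit_sequences\<close>). On the other hand, if \<open>S
  = B \<circ> id \<circ> A\<close>, then each \<open>A (x n)\<close> has a coordinate of size bounded below. By a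
  gliding hump argument, rows \<open>m r\<close> and coordinates \<open>k r \<ge> m (r - 1)\<close> can be chosen such
  that \<open>k 0, \<dots>, k n\<close> being in \<open>H\<close> implies \<open>m 0, \<dots>, m n\<close> being in
  \<open>G c\<close>, with \<open>c\<close> fixed. The extra first entry in the definition of \<open>H\<close> now
  does its work: if \<open>m 0, \<dots>, m (n - 1)\<close> is in \<open>G c\<close>, then \<open>k 0, \<dots>, k
  n\<close> is in \<open>H\<close>, and so \<open>m 0, \<dots>, m n\<close> is in \<open>G c\<close>. This builds an
  infinite branch (\<open>operator_image_uniformly_small_coordinates\<close>), a contradiction. The comparison of
  ranks of trees that is behind this argument is thus carried out without ordinals.

  The spaces have to live in the type of \<open>X\<close>. This is possible because \<open>X\<close> contains a line,
  and hence its type contains a copy of the set of real sequences.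
\<close>

section \<open>Separation in normed spaces\<close>

context normed_vector_space
begin

lemma scale_closed [simp]: "x \<in> carrier X \<Longrightarrow> a \<odot> x \<in> carrier X"
  using smult_closed[of a x] by (simp add: real_field_def)

lemma scale_add_right: "x \<in> carrier X \<Longrightarrow> y \<in> carrier X \<Longrightarrow> a \<odot> (x \<oplus> y) = a \<odot> x \<oplus> a \<odot> y"
  using smult_r_distr[of a x y] by (simp add: real_field_def)

lemma scale_add_left: "x \<in> carrier X \<Longrightarrow> (a + b) \<odot> x = a \<odot> x \<oplus> b \<odot> x"
  using smult_l_distr[of a b x] by (simp add: real_field_def)

lemma scale_scale: "x \<in> carrier X \<Longrightarrow> a \<odot> (b \<odot> x) = (a * b) \<odot> x"
  using smult_assoc1[of a b x] by (simp add: real_field_def)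

lemma scale_one: "x \<in> carrier X \<Longrightarrow> 1 \<odot> x = x"
  using smult_one[of x] by (simp add: real_field_def)

lemma scale_zero_left: "x \<in> carrier X \<Longrightarrow> 0 \<odot> x = \<zero>"
  using smult_l_null[of x] by (simp add: real_field_def)

lemma scale_zero_right: "a \<odot> \<zero> = \<zero>"
  using smult_r_null[of a] by (simp add: real_field_def)

lemma minus_eq_scale: "x \<in> carrier X \<Longrightarrow> \<ominus> x = (- 1) \<odot> x"
  using smult_l_minus[of 1 x] scale_one[of x] ominus_real_field[of 1] by (simp add: real_field_def)

lemma diff_eq_scale: "x \<in> carrier X \<Longrightarrow> y \<in> carrier X \<Longrightarrow> x \<ominus> y = x \<oplus> (- 1) \<odot> y"
  by (simp add: a_minus_def minus_eq_scale)

lemma add_neg_scale: "x \<in> carrier X \<Longrightarrow> x \<oplus> (- 1) \<odot> x = \<zero>"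
  by (metis diff_eq_scale M.r_neg a_minus_def)

text \<open>
  The positive homogeneity is stated as an inequality only; applied to \<open>t\<close> and to \<open>1 / t\<close> it
  gives equality.
\<close>

definition sublinear :: "('a \<Rightarrow> real) \<Rightarrow> bool"
  where "sublinear p \<longleftrightarrow>
    (\<forall>x \<in> carrier X. \<forall>y \<in> carrier X. p (x \<oplus> y) \<le> p x + p y) \<and>
    (\<forall>t > 0. \<forall>x \<in> carrier X. p (t \<odot> x) \<le> t * p x)"

lemma sublinearD:
  assumes "sublinear p" "x \<in> carrier X"
  shows "y \<in> carrier X \<Longrightarrow> p (x \<oplus> y) \<le> p x + p y" "0 < t \<Longrightarrow> p (t \<odot> x) = t * p x"
proof -
  show "y \<in> carrier X \<Longrightarrow> p (x \<oplus> y) \<le> p x + p y"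
    using assms by (auto simp: sublinear_def)
  assume t: "0 < t"
  have "p x = p (inverse t \<odot> (t \<odot> x))"
    using assms t by (simp add: scale_scale scale_one)
  also have "\<dots> \<le> inverse t * p (t \<odot> x)"
    using assms t by (auto simp: sublinear_def)
  finally have "t * p x \<le> p (t \<odot> x)"
    using t by (simp add: field_simps)
  then show "p (t \<odot> x) = t * p x"
    using assms t by (auto simp: sublinear_def intro: antisym)
qed

lemma sublinear_zero: "sublinear p \<Longrightarrow> p \<zero> = 0"
  using sublinearD(2)[of p \<zero> 2] by (simp add: scale_zero_right)

lemma sublinear_ge_neg: "sublinear p \<Longrightarrow> x \<in> carrier X \<Longrightarrow> - p ((- 1) \<odot> x) \<le> p x"
  using sublinearD(1)[of p x "(- 1) \<odot> x"] by (simp add: add_neg_scale sublinear_zero)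

lemma sublinear_vnorm: "sublinear (vnorm X)"
  by (auto simp: sublinear_def vnorm_triangle vnorm_smult)

text \<open>
  A sublinear functional can be lowered along a convex cone \<open>D\<close> of pairs \<open>(u, r)\<close> that lies
  below its graph: put \<open>p' x = inf (p (x + u) - r)\<close>. The infimum exists because \<open>r \<le> p u \<le>
  p (x + u) + p (- x)\<close>, and taking \<open>x = - u\<close> shows that every linear functional below
  \<open>p'\<close> is at least \<open>r\<close> at \<open>u\<close>. The ray spanned by a single \<open>(y, p
  y)\<close> gives the Hahn-Banach theorem below, the cone spanned by a sequence gives the separation argument.
\<close>

lemma sublinear_inf_along_cone:
  fixes D :: "('a \<times> real) set"
  assumes p: "sublinear p"
    and zero: "(\<zero>, 0) \<in> D"
    and add: "\<And>u r v s. (u, r) \<in> D \<Longrightarrow> (v, s) \<in> D \<Longrightarrow> (u \<oplus> v, r + s) \<in> D"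
    and scale: "\<And>t u r. 0 < t \<Longrightarrow> (u, r) \<in> D \<Longrightarrow> (t \<odot> u, t * r) \<in> D"
    and below: "\<And>u r. (u, r) \<in> D \<Longrightarrow> u \<in> carrier X \<and> r \<le> p u"
  shows "\<exists>p'. sublinear p' \<and> (\<forall>x \<in> carrier X. p' x \<le> p x) \<and>
    (\<forall>x. x \<notin> carrier X \<longrightarrow> p' x = 0) \<and>
    (\<forall>u r. (u, r) \<in> D \<longrightarrow> p' ((- 1) \<odot> u) \<le> - r)"
proof -
  define p' where "p' x = (if x \<in> carrier X then INF d\<in>D. p (x \<oplus> fst d) - snd d else 0)" for x
  have lower: "- p ((- 1) \<odot> x) \<le> p (x \<oplus> u) - r" if "x \<in> carrier X" "(u, r) \<in> D" for x u r
  proof -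
    have u: "u \<in> carrier X" "r \<le> p u"
      using below that by auto
    have "u = (x \<oplus> u) \<oplus> (- 1) \<odot> x"
      using that u by (metis M.a_assoc M.a_comm M.r_zero add_neg_scale scale_closed)
    then have "p u \<le> p (x \<oplus> u) + p ((- 1) \<odot> x)"
      using sublinearD(1)[OF p, of "x \<oplus> u" "(- 1) \<odot> x"] that u by simp
    then show ?thesis
      using u by linarith
  qed
  have bdd: "bdd_below ((\<lambda>d. p (x \<oplus> fst d) - snd d) ` D)" if "x \<in> carrier X" for x
    using lower[OF that] by (intro bdd_belowI2[where m = "- p ((- 1) \<odot> x)"]) auto
  have le: "p' x \<le> p (x \<oplus> u) - r" if "x \<in> carrier X" "(u, r) \<in> D" for x u r
    using cINF_lower[OF bdd[OF that(1)] that(2)] that by (simp add: p'_def)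
  have ge: "c \<le> p' x"
    if "x \<in> carrier X" "\<And>u r. (u, r) \<in> D \<Longrightarrow> c \<le> p (x \<oplus> u) - r" for x c
    using that zero by (auto simp: p'_def intro!: cINF_greatest)
  have "sublinear p'"
    unfolding sublinear_def
  proof (intro conjI ballI allI impI)
    fix x y assume xy: "x \<in> carrier X" "y \<in> carrier X"
    have "p' (x \<oplus> y) \<le> (p (x \<oplus> u) - r) + (p (y \<oplus> v) - s)"
      if "(u, r) \<in> D" "(v, s) \<in> D" for u r v s
    proof -
      have uv: "u \<in> carrier X" "v \<in> carrier X"
        using below that by auto
      have "(x \<oplus> y) \<oplus> (u \<oplus> v) = (x \<oplus> u) \<oplus> (y \<oplus> v)"
        using xy uv by (simp add: M.a_ac)
      then have "p ((x \<oplus> y) \<oplus> (u \<oplus> v)) \<le> p (x \<oplus> u) + p (y \<oplus> v)"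
        using sublinearD(1)[OF p, of "x \<oplus> u" "y \<oplus> v"] xy uv by simp
      then show ?thesis
        using le[OF _ add[OF that], of "x \<oplus> y"] xy by simp
    qed
    then have "p' (x \<oplus> y) - (p (x \<oplus> u) - r) \<le> p' y" if "(u, r) \<in> D" for u r
      using that by (intro ge xy) (fastforce simp: algebra_simps)
    then have "p' (x \<oplus> y) - p' y \<le> p' x"
      by (intro ge xy) (simp add: algebra_simps)
    then show "p' (x \<oplus> y) \<le> p' x + p' y"
      by simp
  next
    fix t :: real and x assume t: "0 < t" and x: "x \<in> carrier X"
    have "p' (t \<odot> x) / t \<le> p (x \<oplus> u) - r" if "(u, r) \<in> D" for u r
    proof -
      have u: "u \<in> carrier X"
        using below that by auto
      have "p' (t \<odot> x) \<le> p (t \<odot> x \<oplus> t \<odot> u) - t * r"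
        using le[OF _ scale[OF t that], of "t \<odot> x"] x by simp
      also have "\<dots> = t * (p (x \<oplus> u) - r)"
        using sublinearD(2)[OF p _ t, of "x \<oplus> u"] x u
        by (simp add: scale_add_right algebra_simps)
      finally show ?thesis
        using t by (simp add: field_simps)
    qed
    then have "p' (t \<odot> x) / t \<le> p' x"
      by (intro ge x)
    then show "p' (t \<odot> x) \<le> t * p' x"
      using t by (simp add: field_simps)
  qed
  moreover have "p' x \<le> p x" if "x \<in> carrier X" for x
    using le[OF that zero] that by simp
  moreover have "p' ((- 1) \<odot> u) \<le> - r" if "(u, r) \<in> D" for u r
  proof -
    have u: "u \<in> carrier X"
      using below that by auto
    have "(- 1) \<odot> u \<oplus> u = \<zero>"
      using u by (metis M.a_comm add_neg_scale scale_closed)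
    then show ?thesis
      using le[OF _ that, of "(- 1) \<odot> u"] u sublinear_zero[OF p] by simp
  qed
  ultimately show ?thesis
    by (intro exI[of _ p']) (auto simp: p'_def)
qed

text \<open>
  Lowering a minimal \<open>p\<close> along the ray through \<open>(y, p y)\<close> returns \<open>p\<close>, hence
  \<open>p (- y) \<le> - p y\<close>.
\<close>

lemma minimal_sublinear_odd:
  assumes p: "sublinear p" "\<forall>x. x \<notin> carrier X \<longrightarrow> p x = 0"
    and minimal: "\<And>p'. sublinear p' \<Longrightarrow> \<forall>x \<in> carrier X. p' x \<le> p x \<Longrightarrow>
      \<forall>x. x \<notin> carrier X \<longrightarrow> p' x = 0 \<Longrightarrow> p' = p"
    and y: "y \<in> carrier X"
  shows "p ((- 1) \<odot> y) = - p y"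
proof -
  define D where "D = (\<lambda>t. (t \<odot> y, t * p y)) ` {0 :: real ..}"
  obtain p' where p': "sublinear p'" "\<forall>x \<in> carrier X. p' x \<le> p x"
    "\<forall>x. x \<notin> carrier X \<longrightarrow> p' x = 0" "\<forall>u r. (u, r) \<in> D \<longrightarrow> p' ((- 1) \<odot> u) \<le> - r"
  proof (rule exE[OF sublinear_inf_along_cone[OF p(1), of D]])
    show "(\<zero>, 0) \<in> D"
      using y by (auto simp: D_def scale_zero_left intro!: image_eqI[of _ _ 0])
  next
    fix u r v s assume "(u, r) \<in> D" "(v, s) \<in> D"
    then obtain a b where ab: "0 \<le> a" "0 \<le> b"
      "u = a \<odot> y" "r = a * p y" "v = b \<odot> y" "s = b * p y"
      by (auto simp: D_def)
    have "(u \<oplus> v, r + s) = ((a + b) \<odot> y, (a + b) * p y)"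
      using ab y by (simp add: scale_add_left algebra_simps)
    then show "(u \<oplus> v, r + s) \<in> D"
      using ab by (auto simp: D_def)
  next
    fix t :: real and u r assume "0 < t" "(u, r) \<in> D"
    then show "(t \<odot> u, t * r) \<in> D"
      using y by (auto simp: D_def scale_scale intro!: image_eqI[of _ _ "t * a" for a])
  next
    fix u r assume "(u, r) \<in> D"
    then obtain t where "0 \<le> t" "u = t \<odot> y" "r = t * p y"
      by (auto simp: D_def)
    then show "u \<in> carrier X \<and> r \<le> p u"
      using y sublinearD(2)[OF p(1) y, of t] sublinear_zero[OF p(1)]
      by (cases "t = 0") (auto simp: scale_zero_left)
  qed auto
  have "(y, p y) \<in> D"
    using y by (auto simp: D_def scale_one intro!: image_eqI[of _ _ 1])
  then have "p ((- 1) \<odot> y) \<le> - p y"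
    using p' minimal[OF p'(1-3)] by auto
  then show ?thesis
    using sublinear_ge_neg[OF p(1) y] by linarith
qed

text \<open>
  Hahn-Banach theorem. Zorn's lemma gives a minimal sublinear functional below \<open>q\<close>. It is odd, and an odd
  sublinear functional is linear. No functionals on subspaces are involved. The functionals are set to 0 outside the
  carrier, which makes pointwise comparison antisymmetric.
\<close>

theorem linear_functional_below_sublinear:
  assumes q: "sublinear q"
  obtains f where "\<And>x y. x \<in> carrier X \<Longrightarrow> y \<in> carrier X \<Longrightarrow> f (x \<oplus> y) = f x + f y"
    "\<And>a x. x \<in> carrier X \<Longrightarrow> f (a \<odot> x) = a * f x"
    "\<And>x. x \<in> carrier X \<Longrightarrow> f x \<le> q x"
proof -
  define Sub where "Sub = {p. sublinear p \<and> (\<forall>x \<in> carrier X. p x \<le> q x) \<and>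
    (\<forall>x. x \<notin> carrier X \<longrightarrow> p x = 0)}"
  define ge where "ge p p' \<longleftrightarrow> (\<forall>x. p' x \<le> p x)" for p p' :: "'a \<Rightarrow> real"
  have "\<exists>m \<in> Sub. \<forall>p \<in> Sub. ge m p \<longrightarrow> p = m"
  proof (rule predicate_Zorn)
    show "partial_order_on Sub (relation_of ge Sub)"
      by (rule partial_order_on_relation_ofI)
        (auto simp: ge_def fun_eq_iff intro: order_trans antisym)
  next
    fix C assume C: "C \<in> Chains (relation_of ge Sub)"
    then have sub: "\<And>p. p \<in> C \<Longrightarrow> p \<in> Sub"
      and total: "\<And>p p'. p \<in> C \<Longrightarrow> p' \<in> C \<Longrightarrow> ge p p' \<or> ge p' p"
      by (auto simp: Chains_def relation_of_def)
    show "\<exists>u \<in> Sub. \<forall>p \<in> C. ge p u"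
    proof (cases "C = {}")
      case True
      have "(\<lambda>x. if x \<in> carrier X then q x else 0) \<in> Sub"
        using q by (auto simp: Sub_def sublinear_def)
      then show ?thesis
        using True by blast
    next
      case False
      define u where "u x = (INF p\<in>C. p x)" for x
      have bdd: "bdd_below ((\<lambda>p. p x) ` C)" for x
      proof (rule bdd_belowI2[where m = "if x \<in> carrier X then - q ((- 1) \<odot> x) else 0"])
        fix p assume "p \<in> C"
        then have p: "p \<in> Sub"
          by (rule sub)
        show "(if x \<in> carrier X then - q ((- 1) \<odot> x) else 0) \<le> p x"
        proof (cases "x \<in> carrier X")
          case True
          then have "- q ((- 1) \<odot> x) \<le> - p ((- 1) \<odot> x)"
            using p by (simp add: Sub_def)
          also have "\<dots> \<le> p x"
            using sublinear_ge_neg[of p x] p True by (simp add: Sub_def)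
          finally show ?thesis
            using True by simp
        qed (use p in \<open>auto simp: Sub_def\<close>)
      qed
      have le: "u x \<le> p x" if "p \<in> C" for p x
        unfolding u_def by (rule cINF_lower[OF bdd that])
      have ge': "c \<le> u x" if "\<And>p. p \<in> C \<Longrightarrow> c \<le> p x" for c x
        unfolding u_def using False that by (rule cINF_greatest)
      have "sublinear u"
        unfolding sublinear_def
      proof (intro conjI ballI allI impI)
        fix x y assume xy: "x \<in> carrier X" "y \<in> carrier X"
        have "u (x \<oplus> y) \<le> p x + p' y" if "p \<in> C" "p' \<in> C" for p p'
        proof -
          \<comment> \<open>the smaller of the two members of the chain\<close>
          obtain s where s: "s \<in> C" "s x \<le> p x" "s y \<le> p' y"
            using total[OF \<open>p \<in> C\<close> \<open>p' \<in> C\<close>] \<open>p \<in> C\<close> \<open>p' \<in> C\<close> by (auto simp: ge_def)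
          have "u (x \<oplus> y) \<le> s (x \<oplus> y)"
            by (rule le[OF s(1)])
          also have "\<dots> \<le> s x + s y"
            using sublinearD(1)[of s x y] sub[OF s(1)] xy by (simp add: Sub_def)
          finally show ?thesis
            using s by linarith
        qed
        then have "u (x \<oplus> y) - p x \<le> u y" if "p \<in> C" for p
          using that by (intro ge') (fastforce simp: algebra_simps)
        then have "u (x \<oplus> y) - u y \<le> u x"
          by (intro ge') (simp add: algebra_simps)
        then show "u (x \<oplus> y) \<le> u x + u y"
          by simp
      next
        fix t :: real and x assume t: "0 < t" and x: "x \<in> carrier X"
        have "u (t \<odot> x) / t \<le> p x" if "p \<in> C" for p
          using le[OF that, of "t \<odot> x"] sublinearD(2)[of p x t] sub[OF that] x t
          by (simp add: Sub_def field_simps)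
        then have "u (t \<odot> x) / t \<le> u x"
          by (rule ge')
        then show "u (t \<odot> x) \<le> t * u x"
          using t by (simp add: field_simps)
      qed
      moreover have "u x \<le> q x" if "x \<in> carrier X" for x
        using False sub le[of _ x] that by (fastforce simp: Sub_def)
      moreover have "u x = 0" if "x \<notin> carrier X" for x
      proof -
        have "(\<lambda>p. p x) ` C = {0}"
          using False sub that by (force simp: Sub_def)
        then show ?thesis
          by (simp add: u_def)
      qed
      ultimately have "u \<in> Sub"
        by (simp add: Sub_def)
      then show ?thesis
        using le by (auto simp: ge_def)
    qed
  qed
  then obtain f where f: "f \<in> Sub" and f_min: "\<And>p. p \<in> Sub \<Longrightarrow> ge f p \<Longrightarrow> p = f"
    by blast
  have subl: "sublinear f" and out: "\<forall>x. x \<notin> carrier X \<longrightarrow> f x = 0"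
    using f by (auto simp: Sub_def)
  have odd: "f ((- 1) \<odot> x) = - f x" if "x \<in> carrier X" for x
  proof (rule minimal_sublinear_odd[OF subl out _ that])
    fix p assume p: "sublinear p" "\<forall>x \<in> carrier X. p x \<le> f x" "\<forall>x. x \<notin> carrier X \<longrightarrow> p x = 0"
    then have "p \<in> Sub"
      using f by (force simp: Sub_def)
    moreover have "ge f p"
      unfolding ge_def using p out by (metis order_refl)
    ultimately show "p = f"
      by (rule f_min)
  qed
  show thesis
  proof
    fix x y assume xy: "x \<in> carrier X" "y \<in> carrier X"
    have "x = (x \<oplus> y) \<oplus> (- 1) \<odot> y"
      using xy by (metis M.a_assoc M.r_zero add_neg_scale scale_closed)
    then have "f x \<le> f (x \<oplus> y) + f ((- 1) \<odot> y)"
      using sublinearD(1)[OF subl, of "x \<oplus> y" "(- 1) \<odot> y"] xy by simp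
    then show "f (x \<oplus> y) = f x + f y"
      using sublinearD(1)[OF subl, of x y] odd[of y] xy by simp
  next
    fix a :: real and x assume x: "x \<in> carrier X"
    consider "0 < a" | "a = 0" | "a < 0"
      by linarith
    then show "f (a \<odot> x) = a * f x"
    proof cases
      case 1
      then show ?thesis
        using sublinearD(2)[OF subl x] by simp
    next
      case 2
      then show ?thesis
        using x sublinear_zero[OF subl] by (simp add: scale_zero_left)
    next
      case 3
      then have "f ((- a) \<odot> x) = (- a) * f x"
        using sublinearD(2)[OF subl x, of "- a"] by simp
      moreover have "(- 1) \<odot> ((- a) \<odot> x) = a \<odot> x"
        using x by (simp add: scale_scale)
      ultimately show ?thesis
        using odd[of "(- a) \<odot> x"] x by simp
    qed
  next
    fix x assume "x \<in> carrier X"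
    then show "f x \<le> q x"
      using f by (simp add: Sub_def)
  qed
qed

primrec lincomb :: "(nat \<Rightarrow> 'a) \<Rightarrow> (nat \<Rightarrow> real) \<Rightarrow> nat list \<Rightarrow> 'a"
  where
    "lincomb y a [] = \<zero>"
  | "lincomb y a (i # is) = a i \<odot> y i \<oplus> lincomb y a is"

lemma lincomb_closed [simp]: "range y \<subseteq> carrier X \<Longrightarrow> lincomb y a is \<in> carrier X"
  by (induction "is") (auto simp: image_subset_iff)

lemma lincomb_append:
  "range y \<subseteq> carrier X \<Longrightarrow> lincomb y a (is @ js) = lincomb y a is \<oplus> lincomb y a js"
  by (induction "is") (auto simp: M.a_assoc image_subset_iff)

lemma lincomb_add:
  "range y \<subseteq> carrier X \<Longrightarrow> lincomb y (\<lambda>i. a i + b i) is = lincomb y a is \<oplus> lincomb y b is"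
  by (induction "is") (auto simp: M.a_ac image_subset_iff scale_add_left)

lemma lincomb_scale:
  "range y \<subseteq> carrier X \<Longrightarrow> lincomb y (\<lambda>i. t * a i) is = t \<odot> lincomb y a is"
  by (induction "is") (auto simp: image_subset_iff scale_add_right scale_scale scale_zero_right)

lemma lincomb_cong:
  "(\<And>i. i \<in> set is \<Longrightarrow> a i = b i) \<Longrightarrow> lincomb y a is = lincomb y b is"
  by (induction "is") auto

lemma lincomb_eq_zero:
  "range y \<subseteq> carrier X \<Longrightarrow> (\<And>i. i \<in> set is \<Longrightarrow> a i = 0) \<Longrightarrow> lincomb y a is = \<zero>"
  by (induction "is") (auto simp: image_subset_iff scale_zero_left)

lemma lincomb_map: "lincomb y a (map f is) = lincomb (y \<circ> f) (a \<circ> f) is"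
  by (induction "is") auto

text \<open>
  Mazur's argument: if all nonnegative combinations of a sequence satisfy a lower \<open>l\<^sub>1\<close> estimate,
  then its convex hull has distance at least \<open>c\<close> from 0, and a functional separates the two. So such a
  sequence cannot be weakly null.
\<close>

lemma functional_bounded_below_on_sequence:
  assumes y: "range y \<subseteq> carrier X"
    and l1: "\<And>a n. (\<And>j. 0 \<le> a j) \<Longrightarrow> c * (\<Sum>j<n. a j) \<le> vnorm X (lincomb y a [0..<n])"
  obtains f where "operator X type_space f" "\<And>j. c \<le> f (y j)"
proof -
  define D where "D = {(lincomb y a [0..<n], c * (\<Sum>j<n. a j)) | a n.
    (\<forall>j. 0 \<le> a j) \<and> (\<forall>j \<ge> n. a j = 0)}"
  have DI: "(lincomb y a [0..<n], c * (\<Sum>j<n. a j)) \<in> D"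
    if "\<forall>j. 0 \<le> a j" "\<forall>j \<ge> n. a j = 0" for a n
    using that unfolding D_def by blast
  \<comment> \<open>coefficients that vanish from \<open>n\<close> on make lists of different lengths comparable\<close>
  have pad: "lincomb y a [0..<max n m] = lincomb y a [0..<n] \<and>
      (\<Sum>j<max n m. a j) = (\<Sum>j<n. a j)" if "\<forall>j \<ge> n. a j = 0" for a n m
  proof
    have "[0..<max n m] = [0..<n] @ [n..<max n m]"
      by (metis le_add_diff_inverse max.cobounded1 upt_add_eq_append zero_le)
    moreover have "lincomb y a [n..<max n m] = \<zero>"
      using that by (intro lincomb_eq_zero y) auto
    ultimately show "lincomb y a [0..<max n m] = lincomb y a [0..<n]"
      using y by (simp add: lincomb_append)
    show "(\<Sum>j<max n m. a j) = (\<Sum>j<n. a j)"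
      using that by (intro sum.mono_neutral_right) auto
  qed
  obtain q where q: "sublinear q" "\<forall>x \<in> carrier X. q x \<le> vnorm X x"
    "\<forall>u r. (u, r) \<in> D \<longrightarrow> q ((- 1) \<odot> u) \<le> - r"
  proof (rule exE[OF sublinear_inf_along_cone[OF sublinear_vnorm, of D]])
    show "(\<zero>, 0) \<in> D"
      using DI[of "\<lambda>_. 0" 0] by simp
  next
    fix u r v s assume "(u, r) \<in> D" "(v, s) \<in> D"
    then obtain a n b m where
      a: "u = lincomb y a [0..<n]" "r = c * (\<Sum>j<n. a j)" "\<forall>j. 0 \<le> a j" "\<forall>j \<ge> n. a j = 0" and
      b: "v = lincomb y b [0..<m]" "s = c * (\<Sum>j<m. b j)" "\<forall>j. 0 \<le> b j" "\<forall>j \<ge> m. b j = 0"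
      unfolding D_def by blast
    show "(u \<oplus> v, r + s) \<in> D"
      using DI[of "\<lambda>j. a j + b j" "max n m"] a b y pad[of n a m] pad[of m b n]
      by (simp add: lincomb_add sum.distrib algebra_simps max.commute)
  next
    fix t :: real and u r assume t: "0 < t" and "(u, r) \<in> D"
    then obtain a n where
      a: "u = lincomb y a [0..<n]" "r = c * (\<Sum>j<n. a j)" "\<forall>j. 0 \<le> a j" "\<forall>j \<ge> n. a j = 0"
      unfolding D_def by blast
    show "(t \<odot> u, t * r) \<in> D"
      using DI[of "\<lambda>j. t * a j" n] a t y
      by (simp add: lincomb_scale sum_distrib_left algebra_simps)
  next
    fix u r assume "(u, r) \<in> D"
    then show "u \<in> carrier X \<and> r \<le> vnorm X u"
      using y l1 by (auto simp: D_def)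
  qed auto
  obtain f where f: "\<And>x y. x \<in> carrier X \<Longrightarrow> y \<in> carrier X \<Longrightarrow> f (x \<oplus> y) = f x + f y"
    "\<And>a x. x \<in> carrier X \<Longrightarrow> f (a \<odot> x) = a * f x" "\<And>x. x \<in> carrier X \<Longrightarrow> f x \<le> q x"
    by (rule linear_functional_below_sublinear[OF q(1)]) blast
  show thesis
  proof
    have "\<bar>f x\<bar> \<le> 1 * vnorm X x" if x: "x \<in> carrier X" for x
    proof -
      have "f ((- 1) \<odot> x) \<le> vnorm X ((- 1) \<odot> x)"
        using order_trans[OF f(3) bspec[OF q(2)], of "(- 1) \<odot> x"] x by simp
      moreover have "f x \<le> vnorm X x"
        using order_trans[OF f(3) bspec[OF q(2)], of x] x by simp
      ultimately show ?thesis
        using f(2)[OF x, of "- 1"] vnorm_smult[OF x, of "- 1"] by simp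
    qed
    then show "operator X type_space f"
      using f by (auto simp: operator_def intro!: exI[of _ 1])
  next
    fix j
    have yj: "y j \<in> carrier X"
      using y by auto
    define a where "a i = (if i = j then 1 else 0 :: real)" for i
    have "lincomb y a [0..<Suc j] = lincomb y a [0..<j] \<oplus> lincomb y a [j]"
      using lincomb_append[OF y, of a "[0..<j]" "[j]"] by simp
    also have "lincomb y a [0..<j] = \<zero>"
      by (rule lincomb_eq_zero[OF y]) (auto simp: a_def)
    also have "lincomb y a [j] = y j"
      using yj by (simp add: a_def scale_one)
    finally have "lincomb y a [0..<Suc j] = y j"
      using yj by simp
    moreover have "(\<Sum>i<Suc j. a i) = 1"
      by (simp add: a_def)
    moreover have "(lincomb y a [0..<Suc j], c * (\<Sum>i<Suc j. a i)) \<in> D"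
      by (rule DI) (auto simp: a_def)
    ultimately have "(y j, c) \<in> D"
      by simp
    then have "f ((- 1) \<odot> y j) \<le> - c"
      using q(3) f(3)[of "(- 1) \<odot> y j"] yj by force
    then show "c \<le> f (y j)"
      using f(2)[OF yj, of "- 1"] by simp
  qed
qed

end

section \<open>Families of lists that are small in the sense of Ptak\<close>

abbreviation increasing :: "nat list \<Rightarrow> bool"
  where "increasing \<equiv> sorted_wrt (<)"

abbreviation sum_over :: "(nat \<Rightarrow> real) \<Rightarrow> nat list \<Rightarrow> real"
  where "sum_over d E \<equiv> sum_list (map d E)"

text \<open>
  An abstraction of the set of all convex combinations of a sequence of successive blocks; the only properties of
  blocks that matter are convexity and the presence of members with arbitrarily late support. The bound by 1 holds in
  particular for subprobability vectors.
\<close>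

definition tail_convex :: "(nat \<Rightarrow> real) set \<Rightarrow> bool"
  where "tail_convex D \<longleftrightarrow>
    (\<forall>d \<in> D. (\<exists>s. \<forall>n > s. d n = 0) \<and> (\<forall>E. increasing E \<longrightarrow> sum_over d E \<le> 1)) \<and>
    (\<forall>d \<in> D. \<forall>d' \<in> D. \<forall>t. 0 \<le> t \<longrightarrow> t \<le> 1 \<longrightarrow> (\<lambda>n. (1 - t) * d n + t * d' n) \<in> D) \<and>
    (\<forall>s. \<exists>d \<in> D. \<forall>n \<le> s. d n = 0)"

lemma tail_convexI:
  assumes "\<And>d. d \<in> D \<Longrightarrow> \<exists>s. \<forall>n > s. d n = 0"
    and "\<And>d E. d \<in> D \<Longrightarrow> increasing E \<Longrightarrow> sum_over d E \<le> 1"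
    and "\<And>d d' t. d \<in> D \<Longrightarrow> d' \<in> D \<Longrightarrow> 0 \<le> t \<Longrightarrow> t \<le> 1 \<Longrightarrow>
      (\<lambda>n. (1 - t) * d n + t * d' n) \<in> D"
    and "\<And>s. \<exists>d \<in> D. \<forall>n \<le> s. d n = 0"
  shows "tail_convex D"
  unfolding tail_convex_def by (intro conjI ballI allI impI assms)

lemma tail_convexD:
  assumes "tail_convex D"
  shows "d \<in> D \<Longrightarrow> \<exists>s. \<forall>n > s. d n = 0"
    and "d \<in> D \<Longrightarrow> increasing E \<Longrightarrow> sum_over d E \<le> 1"
    and "d \<in> D \<Longrightarrow> d' \<in> D \<Longrightarrow> 0 \<le> t \<Longrightarrow> t \<le> 1 \<Longrightarrow>
      (\<lambda>n. (1 - t) * d n + t * d' n) \<in> D"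
    and "\<exists>d \<in> D. \<forall>n \<le> s. d n = 0"
  using assms unfolding tail_convex_def by simp_all

text \<open>
  Smallness of a family of lists in the sense of Ptak's combinatorial lemma: convex combinations can be spread out so
  evenly that no list of the family carries a substantial part of their mass. The quantification over all sets
  \<open>D\<close>, rather than over the infinite subsets of the natural numbers, is what makes negligible families
  closed under finite unions.
\<close>

definition negligible :: "nat list set \<Rightarrow> bool"
  where "negligible K \<longleftrightarrow>
    (\<forall>D. tail_convex D \<longrightarrow> (\<forall>e > 0. \<exists>d \<in> D. \<forall>E \<in> K. sum_over d E \<le> e))"

lemma negligibleE:
  assumes "negligible K" "tail_convex D" "0 < e"
  obtains d where "d \<in> D" "\<And>E. E \<in> K \<Longrightarrow> sum_over d E \<le> e"
  using assms unfolding negligible_def by blast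

lemma sum_over_convex:
  "sum_over (\<lambda>n. (1 - t) * d n + t * d' n) E = (1 - t) * sum_over d E + t * sum_over d' E"
  by (simp add: sum_list_addf sum_list_const_mult)

lemma negligible_subset: "negligible K \<Longrightarrow> K' \<subseteq> K \<Longrightarrow> negligible K'"
  unfolding negligible_def by (meson subsetD)

lemma tail_convex_drop:
  assumes "tail_convex D"
  shows "tail_convex {d \<in> D. \<forall>n \<le> s. d n = 0}"
proof (rule tail_convexI)
  fix s'
  obtain d where "d \<in> D" "\<forall>n \<le> max s s'. d n = 0"
    using tail_convexD(4)[OF assms] by blast
  then show "\<exists>d \<in> {d \<in> D. \<forall>n \<le> s. d n = 0}. \<forall>n \<le> s'. d n = 0"
    by (intro bexI[of _ d]) simp_all
qed (use tail_convexD[OF assms] in simp_all)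

lemma negligible_tail_convex:
  assumes "negligible K" "tail_convex D" "0 < e"
  shows "tail_convex {d \<in> D. \<forall>E \<in> K. sum_over d E \<le> e}"
proof (rule tail_convexI)
  fix s
  obtain d where "d \<in> {d \<in> D. \<forall>n \<le> s. d n = 0}" "\<And>E. E \<in> K \<Longrightarrow> sum_over d E \<le> e"
    by (rule negligibleE[OF assms(1) tail_convex_drop[OF assms(2), of s] assms(3)]) blast
  then show "\<exists>d \<in> {d \<in> D. \<forall>E \<in> K. sum_over d E \<le> e}. \<forall>n \<le> s. d n = 0"
    by (intro bexI[of _ d]) simp_all
next
  fix d d' and t :: real
  assume d: "d \<in> {d \<in> D. \<forall>E \<in> K. sum_over d E \<le> e}"
    "d' \<in> {d \<in> D. \<forall>E \<in> K. sum_over d E \<le> e}" and t: "0 \<le> t" "t \<le> 1"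
  have "sum_over (\<lambda>n. (1 - t) * d n + t * d' n) E \<le> e" if "E \<in> K" for E
    unfolding sum_over_convex
    using convex_bound_le[of "sum_over d E" e "sum_over d' E" "1 - t" t] d t that by simp
  then show "(\<lambda>n. (1 - t) * d n + t * d' n) \<in> {d \<in> D. \<forall>E \<in> K. sum_over d E \<le> e}"
    using tail_convexD(3)[OF assms(2)] d t by simp
qed (use tail_convexD[OF assms(2)] in simp_all)

text \<open>
  The members of \<open>D\<close> that are small on \<open>K\<close> form again a set to which negligibility of
  \<open>K'\<close> applies.
\<close>

lemma negligible_Un:
  assumes "negligible K" "negligible K'"
  shows "negligible (K \<union> K')"
  unfolding negligible_def
proof (intro allI impI)
  fix D and e :: real assume D: "tail_convex D" and e: "0 < e"
  obtain d where "d \<in> {d \<in> D. \<forall>E \<in> K. sum_over d E \<le> e}" "\<And>E. E \<in> K' \<Longrightarrow> sum_over d E \<le> e"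
    by (rule negligibleE[OF assms(2) negligible_tail_convex[OF assms(1) D e] e]) blast
  then show "\<exists>d \<in> D. \<forall>E \<in> K \<union> K'. sum_over d E \<le> e"
    by (intro bexI[of _ d]) auto
qed

lemma negligible_empty: "negligible {}"
proof -
  have "D \<noteq> {}" if "tail_convex D" for D
    using tail_convexD(4)[OF that] by blast
  then show ?thesis
    unfolding negligible_def by blast
qed

lemma negligible_UN_atMost:
  assumes "\<And>i. negligible (K i)"
  shows "negligible (\<Union>i \<le> (s :: nat). K i)"
  by (induction s) (auto simp: atMost_Suc assms intro: negligible_Un)

text \<open>
  The first entry \<open>n\<close> of a list decides which of the families its remainder may come from, and only
  finitely many of them are allowed. This is the successor step, and at the same time the diagonal limit step, of the
  usual transfinite construction of Schreier families.
\<close>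

definition diagonal_step :: "(nat \<Rightarrow> nat list set) \<Rightarrow> nat list set"
  where "diagonal_step K =
    insert [] {n # E | n E. increasing (n # E) \<and> (\<exists>i \<le> n. E \<in> K i)}"

text \<open>
  Average \<open>L\<close> vectors with successive supports, each of them at most \<open>e / 2\<close> on all families
  admitted by first entries up to the end of the previous support. A list collects at most 1 from the vector in whose
  range it starts, nothing from the earlier ones, and at most \<open>e / 2\<close> from each later vector. So on the
  list the average is at most \<open>1 / L + e / 2\<close>.
\<close>

lemma negligible_diagonal_step:
  assumes K: "\<And>i. negligible (K i)"
  shows "negligible (diagonal_step K)"
  unfolding negligible_def
proof (intro allI impI)
  fix D and e :: real assume D: "tail_convex D" and e: "0 < e"
  have fin: "\<exists>s. \<forall>n > s. d n = 0" and one: "increasing E \<Longrightarrow> sum_over d E \<le> 1"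
    if "d \<in> D" for d E
    using tail_convexD[OF D] that by simp_all
  have zero: "sum_over d E = 0" if "\<And>n. n \<in> set E \<Longrightarrow> d n = 0" for d :: "nat \<Rightarrow> real" and E
    using that by (induction E) auto
  have avg: "\<exists>d \<in> D. \<forall>E \<in> diagonal_step K. real L * sum_over d E \<le> 1 + real L * (e / 2)" for L
  proof (induction L)
    case 0
    have "\<exists>d. d \<in> D"
      using tail_convexD(4)[OF D] by blast
    then show ?case
      by auto
  next
    case (Suc L)
    then obtain d where d: "d \<in> D"
      "\<And>E. E \<in> diagonal_step K \<Longrightarrow> real L * sum_over d E \<le> 1 + real L * (e / 2)"
      by blast
    obtain s where s: "\<And>n. s < n \<Longrightarrow> d n = 0"
      using fin[OF d(1)] by blast
    obtain d' where d'_in: "d' \<in> {d \<in> D. \<forall>n \<le> s. d n = 0}"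
      and d'_small: "\<And>E. E \<in> (\<Union>i \<le> s. K i) \<Longrightarrow> sum_over d' E \<le> e / 2"
      by (rule negligibleE[OF negligible_UN_atMost[of K s, OF K] tail_convex_drop[OF D, of s] half_gt_zero[OF e]])
        blast
    have d': "d' \<in> D" "\<And>n. n \<le> s \<Longrightarrow> d' n = 0"
      "\<And>i E. i \<le> s \<Longrightarrow> E \<in> K i \<Longrightarrow> sum_over d' E \<le> e / 2"
      using d'_in d'_small by auto
    \<comment> \<open>\<open>d\<close> averages \<open>L\<close> vectors, and \<open>f\<close> averages these and \<open>d'\<close>\<close>
    define t where "t = 1 / real (Suc L)"
    define f where "f = (\<lambda>n. (1 - t) * d n + t * d' n)"
    have t: "0 \<le> t" "t \<le> 1" "real (Suc L) * t = 1" "real (Suc L) * (1 - t) = real L"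
      by (auto simp: t_def field_simps)
    have "f \<in> D"
      unfolding f_def by (rule tail_convexD(3)[OF D d(1) d'(1) t(1,2)])
    moreover have "real (Suc L) * sum_over f E \<le> 1 + real (Suc L) * (e / 2)"
      if E: "E \<in> diagonal_step K" for E
    proof -
      have "real (Suc L) * sum_over f E =
          (real (Suc L) * (1 - t)) * sum_over d E + (real (Suc L) * t) * sum_over d' E"
        unfolding f_def sum_over_convex by (simp only: distrib_left mult.assoc)
      then have eq: "real (Suc L) * sum_over f E = real L * sum_over d E + sum_over d' E"
        by (simp only: t mult_1)
      show ?thesis
      proof (cases E)
        case Nil
        then show ?thesis
          using e by simp
      next
        case (Cons n E')
        then obtain i where i: "increasing (n # E')" "i \<le> n" "E' \<in> K i"
          using E by (auto simp: diagonal_step_def)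
        show ?thesis
        proof (cases "n \<le> s")
          case True
          then have "sum_over d' E \<le> e / 2"
            using d'(2)[of n] d'(3)[of i E'] i Cons by simp
          moreover have "real (Suc L) * (e / 2) = real L * (e / 2) + e / 2"
            by (simp add: algebra_simps add_divide_distrib)
          ultimately show ?thesis
            using eq d(2)[OF E] by linarith
        next
          case False
          then have "sum_over d E = 0"
            using i(1) Cons s by (intro zero) auto
          then have "real (Suc L) * sum_over f E = sum_over d' E"
            using eq by simp
          also have "\<dots> \<le> 1"
            by (rule one[OF d'(1)]) (use i(1) Cons in simp)
          also have "\<dots> \<le> 1 + real (Suc L) * (e / 2)"
            using e by simp
          finally show ?thesis .
        qed
      qed
    qed
    ultimately show ?case
      by blast
  qed
  obtain L where L: "2 / e < real L"
    using reals_Archimedean2 by blast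
  then have "0 < real L"
    using e by (meson divide_pos_pos less_trans zero_less_numeral)
  obtain d where d: "d \<in> D"
    "\<And>E. E \<in> diagonal_step K \<Longrightarrow> real L * sum_over d E \<le> 1 + real L * (e / 2)"
    using avg[of L] by blast
  have "sum_over d E \<le> e" if "E \<in> diagonal_step K" for E
  proof -
    have "real L * sum_over d E \<le> real L * e"
      using d(2)[OF that] L e by (simp add: field_simps)
    then show ?thesis
      using \<open>0 < real L\<close> by simp
  qed
  then show "\<exists>d \<in> D. \<forall>E \<in> diagonal_step K. sum_over d E \<le> e"
    using d(1) by blast
qed

text \<open>
  Shifting the entries of a list to the right; families closed under this operation are called spreading.
\<close>

definition spreads :: "nat list set \<Rightarrow> nat list set"
  where "spreads G = {E. increasing E \<and> (\<exists>F \<in> G. list_all2 (\<le>) F E)}"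

text \<open>
  Regard \<open>G\<close> as a tree, which is well-founded as it has no infinite branch. The spreads of the
  continuations of a node \<open>F\<close> are contained in the \<^const>\<open>diagonal_step\<close> of those of its
  children: a first entry \<open>n\<close> is a shift of one of the finitely many children \<open>i \<le> n\<close>.
  So well-founded induction applies.
\<close>

lemma negligible_spreads:
  assumes prefix: "\<And>F F'. F @ F' \<in> G \<Longrightarrow> F \<in> G"
    and suffix: "\<And>F F'. F @ F' \<in> G \<Longrightarrow> F' \<in> G"
    and no_branch: "\<nexists>i. \<forall>n. map i [0..<n] \<in> G"
  shows "negligible (spreads G)"
proof -
  define R where "R = {(F @ [i], F) | F i. F @ [i] \<in> G}"
  define ext where "ext F = {E. increasing E \<and> (\<exists>F'. F @ F' \<in> G \<and> list_all2 (\<le>) F' E)}" for F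
  have "wf R"
    unfolding wf_iff_no_infinite_down_chain
  proof
    assume "\<exists>f. \<forall>n. (f (Suc n), f n) \<in> R"
    then obtain f where f: "\<And>n. (f (Suc n), f n) \<in> R"
      by blast
    have "\<exists>i. f (Suc n) = f n @ [i] \<and> f (Suc n) \<in> G" for n
      using f[of n] by (auto simp: R_def)
    then obtain i where i: "\<And>n. f (Suc n) = f n @ [i n]" "\<And>n. f (Suc n) \<in> G"
      by metis
    have "f n = f 0 @ map i [0..<n]" for n
      by (induction n) (auto simp: i(1))
    then have "map i [0..<Suc n] \<in> G" for n
      using i(2)[of n] suffix by metis
    then have "map i [0..<n] \<in> G" for n
      using prefix[of "map i [0..<n]" "[i n]"] by simp
    then show False
      using no_branch by blast
  qed
  then have "negligible (ext F)" for F
  proof (induction F rule: wf_induct_rule)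
    case (less F)
    have "negligible (ext (F @ [i]))" for i
    proof (cases "F @ [i] \<in> G")
      case True
      then show ?thesis
        using less by (auto simp: R_def)
    next
      case False
      then have "ext (F @ [i]) = {}"
        using prefix[of "F @ [i]"] by (auto simp: ext_def)
      then show ?thesis
        by (simp add: negligible_empty)
    qed
    moreover have "ext F \<subseteq> diagonal_step (\<lambda>i. ext (F @ [i]))"
    proof
      fix E assume "E \<in> ext F"
      then obtain F' where F': "increasing E" "F @ F' \<in> G" "list_all2 (\<le>) F' E"
        by (auto simp: ext_def)
      show "E \<in> diagonal_step (\<lambda>i. ext (F @ [i]))"
      proof (cases E)
        case (Cons n E')
        then obtain i F'' where "F' = i # F''" "i \<le> n" "list_all2 (\<le>) F'' E'"
          using F'(3) by (auto simp: list_all2_Cons2)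
        then show ?thesis
          using F' Cons by (auto simp: diagonal_step_def ext_def)
      qed (simp add: diagonal_step_def)
    qed
    ultimately show ?case
      by (meson negligible_diagonal_step negligible_subset)
  qed
  then have "negligible (ext [])" .
  then show ?thesis
    by (rule negligible_subset) (auto simp: ext_def spreads_def)
qed

section \<open>Sequence spaces of Schreier type\<close>

text \<open>
  The null sequences with finite norm, where the norm is the supremum of the \<open>l\<^sub>1\<close> norms over the
  lists in \<open>H\<close>. For the family of one-element lists this is the space \<open>c\<^sub>0\<close>.
\<close>

definition null_sequences :: "nat list set \<Rightarrow> (nat \<Rightarrow> real) set"
  where "null_sequences H =
    {a. a \<longlonglongrightarrow> 0 \<and> bdd_above ((\<lambda>E. sum_over (\<lambda>n. \<bar>a n\<bar>) E) ` H)}"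

definition list_norm :: "nat list set \<Rightarrow> (nat \<Rightarrow> real) \<Rightarrow> real"
  where "list_norm H a = (SUP E\<in>H. sum_over (\<lambda>n. \<bar>a n\<bar>) E)"

text \<open>
  The spaces are transported along an injection \<open>\<iota>\<close> into the type of the given operator.
\<close>

definition sequence_space :: "((nat \<Rightarrow> real) \<Rightarrow> 'u) \<Rightarrow> nat list set \<Rightarrow> 'u normed_structure"
  where "sequence_space \<iota> H =
    \<lparr>carrier = \<iota> ` null_sequences H, mult = undefined, one = undefined, zero = \<iota> (\<lambda>_. 0),
     add = (\<lambda>u v. \<iota> (\<lambda>n. inv_into UNIV \<iota> u n + inv_into UNIV \<iota> v n)),
     smult = (\<lambda>t u. \<iota> (\<lambda>n. t * inv_into UNIV \<iota> u n)), vnorm = (\<lambda>u. list_norm H (inv_into UNIV \<iota> u))\<rparr>"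

definition unit_sequence :: "nat \<Rightarrow> nat \<Rightarrow> real"
  where "unit_sequence n k = (if k = n then 1 else 0)"

lemma sum_over_add: "sum_over (\<lambda>n. a n + b n) E = sum_over a E + sum_over b E"
  by (rule sum_list_addf)

lemma sum_over_scale: "sum_over (\<lambda>n. t * a n) E = t * sum_over a E"
  by (rule sum_list_const_mult)

lemma sum_over_nonneg: "(\<And>n. 0 \<le> a n) \<Longrightarrow> 0 \<le> sum_over a E"
  by (induction E) auto

lemma sum_over_le_sum:
  assumes "increasing E" "\<And>n. 0 \<le> d n" "\<And>n. s < n \<Longrightarrow> d n = 0"
  shows "sum_over d E \<le> (\<Sum>n\<le>s. d n)"
proof -
  have "distinct E"
    using assms(1) by (simp add: strict_sorted_iff)
  then have "sum_over d E = (\<Sum>n\<in>set E. d n)"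
    by (rule sum_list_distinct_conv_sum_set)
  also have "\<dots> = (\<Sum>n\<in>set E \<inter> {..s}. d n)"
    using assms(3) by (intro sum.mono_neutral_right) (auto simp: not_le)
  also have "\<dots> \<le> (\<Sum>n\<le>s. d n)"
    using assms(2) by (intro sum_mono2) auto
  finally show ?thesis .
qed

lemma tendsto_sum_over:
  assumes "\<And>i. (\<lambda>n. a n i) \<longlonglongrightarrow> b i"
  shows "(\<lambda>n. sum_over (a n) E) \<longlonglongrightarrow> sum_over b E"
  by (induction E) (auto intro!: tendsto_add assms)

context
  fixes \<iota> :: "(nat \<Rightarrow> real) \<Rightarrow> 'u" and H :: "nat list set"
  assumes inj: "inj \<iota>" and singletons: "\<And>n. [n] \<in> H" and incr: "\<And>E. E \<in> H \<Longrightarrow> increasing E"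
begin

lemma sum_over_le_list_norm:
  "a \<in> null_sequences H \<Longrightarrow> E \<in> H \<Longrightarrow> sum_over (\<lambda>n. \<bar>a n\<bar>) E \<le> list_norm H a"
  unfolding list_norm_def null_sequences_def by (auto intro: cSUP_upper2)

lemma list_norm_le:
  "(\<And>E. E \<in> H \<Longrightarrow> sum_over (\<lambda>n. \<bar>a n\<bar>) E \<le> c) \<Longrightarrow> list_norm H a \<le> c"
  unfolding list_norm_def using singletons by (intro cSUP_least) auto

lemma null_sequencesI:
  assumes "a \<longlonglongrightarrow> 0" "\<And>E. E \<in> H \<Longrightarrow> sum_over (\<lambda>n. \<bar>a n\<bar>) E \<le> c"
  shows "a \<in> null_sequences H"
proof -
  have "bdd_above ((\<lambda>E. sum_over (\<lambda>n. \<bar>a n\<bar>) E) ` H)"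
    by (rule bdd_aboveI2) (rule assms(2))
  then show ?thesis
    using assms(1) by (simp add: null_sequences_def)
qed

lemma abs_le_list_norm: "a \<in> null_sequences H \<Longrightarrow> \<bar>a n\<bar> \<le> list_norm H a"
  using sum_over_le_list_norm[OF _ singletons[of n]] by simp

lemma sum_over_abs_add_le:
  assumes "a \<in> null_sequences H" "b \<in> null_sequences H" "E \<in> H"
  shows "sum_over (\<lambda>n. \<bar>a n + b n\<bar>) E \<le> list_norm H a + list_norm H b"
proof -
  have "sum_over (\<lambda>n. \<bar>a n + b n\<bar>) E \<le> sum_over (\<lambda>n. \<bar>a n\<bar> + \<bar>b n\<bar>) E"
    by (rule sum_list_mono) (rule abs_triangle_ineq)
  then show ?thesis
    using sum_over_le_list_norm[OF assms(1,3)] sum_over_le_list_norm[OF assms(2,3)]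
    unfolding sum_over_add by linarith
qed

lemma null_sequences_add:
  "a \<in> null_sequences H \<Longrightarrow> b \<in> null_sequences H \<Longrightarrow> (\<lambda>n. a n + b n) \<in> null_sequences H"
  by (rule null_sequencesI[OF _ sum_over_abs_add_le])
    (auto simp: null_sequences_def intro: tendsto_add_zero)

lemma null_sequences_scale:
  assumes "a \<in> null_sequences H" shows "(\<lambda>n. t * a n) \<in> null_sequences H"
proof (rule null_sequencesI)
  show "(\<lambda>n. t * a n) \<longlonglongrightarrow> 0"
    using assms by (auto simp: null_sequences_def intro: tendsto_mult_right_zero)
  show "sum_over (\<lambda>n. \<bar>t * a n\<bar>) E \<le> \<bar>t\<bar> * list_norm H a" if "E \<in> H" for E
    using sum_over_le_list_norm[OF assms that]
    by (simp add: abs_mult sum_over_scale mult_left_mono)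
qed

lemma list_norm_scale:
  assumes "a \<in> null_sequences H" shows "list_norm H (\<lambda>n. t * a n) = \<bar>t\<bar> * list_norm H a"
proof -
  have le: "list_norm H (\<lambda>n. t * a n) \<le> \<bar>t\<bar> * list_norm H a"
    if "a \<in> null_sequences H" for t a
    using sum_over_le_list_norm[OF that]
    by (intro list_norm_le) (simp add: abs_mult sum_over_scale mult_left_mono)
  show ?thesis
  proof (cases "t = 0")
    case True
    have "0 \<le> list_norm H (\<lambda>n. t * a n)"
      using abs_le_list_norm[OF null_sequences_scale[OF assms], of t 0] by linarith
    then show ?thesis
      using le[OF assms, of t] True by simp
  next
    case False
    then have "list_norm H a \<le> \<bar>inverse t\<bar> * list_norm H (\<lambda>n. t * a n)"
      using le[OF null_sequences_scale[OF assms], of "inverse t" t]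
      by (simp add: mult.assoc[symmetric])
    then have "\<bar>t\<bar> * list_norm H a \<le> list_norm H (\<lambda>n. t * a n)"
      using False by (simp add: field_simps)
    then show ?thesis
      using le[OF assms, of t] by linarith
  qed
qed

lemma finite_support_null_sequences:
  assumes "\<And>n. s < n \<Longrightarrow> a n = 0"
  shows "a \<in> null_sequences H"
proof (rule null_sequencesI)
  show "a \<longlonglongrightarrow> 0"
    using assms by (intro tendsto_eventually eventually_sequentiallyI[of "Suc s"]) simp
  show "sum_over (\<lambda>n. \<bar>a n\<bar>) E \<le> (\<Sum>n\<le>s. \<bar>a n\<bar>)" if "E \<in> H" for E
    using assms by (intro sum_over_le_sum incr that) auto
qed

lemma sequence_space_simps [simp]:
  "carrier (sequence_space \<iota> H) = \<iota> ` null_sequences H"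
  "\<zero>\<^bsub>sequence_space \<iota> H\<^esub> = \<iota> (\<lambda>_. 0)"
  "\<iota> a \<oplus>\<^bsub>sequence_space \<iota> H\<^esub> \<iota> b = \<iota> (\<lambda>n. a n + b n)"
  "t \<odot>\<^bsub>sequence_space \<iota> H\<^esub> \<iota> a = \<iota> (\<lambda>n. t * a n)"
  "vnorm (sequence_space \<iota> H) (\<iota> a) = list_norm H a"
  using inj by (simp_all add: sequence_space_def)

lemma zero_null_sequences: "(\<lambda>_. 0) \<in> null_sequences H"
  by (rule finite_support_null_sequences[of 0]) simp

lemma normed_vector_space_sequence_space: "normed_vector_space (sequence_space \<iota> H)"
proof -
  have "abelian_group (sequence_space \<iota> H)"
  proof (rule abelian_groupI)
    fix u assume "u \<in> carrier (sequence_space \<iota> H)"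
    then obtain a where a: "u = \<iota> a" "a \<in> null_sequences H"
      by auto
    then show "\<exists>v \<in> carrier (sequence_space \<iota> H).
        v \<oplus>\<^bsub>sequence_space \<iota> H\<^esub> u = \<zero>\<^bsub>sequence_space \<iota> H\<^esub>"
      using null_sequences_scale[OF a(2), of "- 1"]
      by (intro bexI[of _ "\<iota> (\<lambda>n. - a n)"]) auto
  qed (auto simp: null_sequences_add zero_null_sequences add_ac)
  then have "Module.module real_field (sequence_space \<iota> H)"
    by (intro moduleI[OF cring_real_field])
      (auto simp: real_field_def null_sequences_scale algebra_simps)
  then show ?thesis
  proof (intro normed_vector_space.intro normed_vector_space_axioms.intro)
    fix u assume "u \<in> carrier (sequence_space \<iota> H)"
    then obtain a where a: "u = \<iota> a" "a \<in> null_sequences H"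
      by auto
    show "0 \<le> vnorm (sequence_space \<iota> H) u"
      using abs_le_list_norm[OF a(2), of 0] a by simp
    have "list_norm H (\<lambda>_. 0) = 0"
      using list_norm_scale[OF zero_null_sequences, of 0] by simp
    moreover have "a = (\<lambda>_. 0)" if "list_norm H a = 0"
      using abs_le_list_norm[OF a(2)] that by (simp add: fun_eq_iff)
    ultimately show "vnorm (sequence_space \<iota> H) u = 0 \<longleftrightarrow> u = \<zero>\<^bsub>sequence_space \<iota> H\<^esub>"
      using a inj by (auto simp: inj_eq)
  qed (auto simp: list_norm_scale intro!: list_norm_le sum_over_abs_add_le)
qed

lemma sequence_space_diff:
  assumes "a \<in> null_sequences H" "b \<in> null_sequences H"
  shows "\<iota> a \<ominus>\<^bsub>sequence_space \<iota> H\<^esub> \<iota> b = \<iota> (\<lambda>n. a n - b n)"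
proof -
  interpret normed_vector_space "sequence_space \<iota> H"
    by (rule normed_vector_space_sequence_space)
  show ?thesis
    using assms by (simp add: diff_eq_scale)
qed

text \<open>
  Coordinatewise limits of Cauchy sequences are limits in norm, since each \<open>l\<^sub>1\<close> norm over a list
  depends on finitely many coordinates and therefore passes to the limit.
\<close>

lemma banach_space_sequence_space: "banach_space (sequence_space \<iota> H)"
proof -
  let ?B = "sequence_space \<iota> H"
  interpret normed_vector_space ?B
    by (rule normed_vector_space_sequence_space)
  interpret Metric_space "carrier ?B" "vdist ?B"
    by (rule Metric_space_vdist)
  have "\<exists>x. limitin mtopology \<sigma> x sequentially" if \<sigma>: "MCauchy \<sigma>" for \<sigma>
  proof -
    have range: "range \<sigma> \<subseteq> carrier ?B"
      using \<sigma> unfolding MCauchy_def by blast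
    then have "\<exists>a. \<sigma> k = \<iota> a \<and> a \<in> null_sequences H" for k
      by auto
    then obtain a where a: "\<And>k. \<sigma> k = \<iota> (a k)" "\<And>k. a k \<in> null_sequences H"
      by metis
    have diff_in: "(\<lambda>i. a k i - a l i) \<in> null_sequences H" for k l
      using null_sequences_add[OF a(2)[of k] null_sequences_scale[OF a(2)[of l], of "- 1"]] by simp
    have dist: "vdist ?B (\<sigma> k) (\<sigma> l) = list_norm H (\<lambda>i. a k i - a l i)" for k l
      using a by (simp add: vdist_def sequence_space_diff)
    have cauchy: "\<exists>N. \<forall>k\<ge>N. \<forall>l\<ge>N. list_norm H (\<lambda>i. a k i - a l i) < e" if "0 < e" for e
    proof -
      from \<sigma> have "\<forall>e>0. \<exists>N. \<forall>k l. N \<le> k \<longrightarrow> N \<le> l \<longrightarrow> vdist ?B (\<sigma> k) (\<sigma> l) < e"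
        unfolding MCauchy_def by (rule conjunct2)
      with that obtain N where "\<forall>k l. N \<le> k \<longrightarrow> N \<le> l \<longrightarrow> vdist ?B (\<sigma> k) (\<sigma> l) < e"
        by meson
      then show ?thesis
        unfolding dist by (intro exI[of _ N]) simp
    qed
    have "Cauchy (\<lambda>k. a k i)" for i
    proof (rule metric_CauchyI)
      fix e :: real assume "0 < e"
      then obtain N where N: "\<And>k l. N \<le> k \<Longrightarrow> N \<le> l \<Longrightarrow> list_norm H (\<lambda>i. a k i - a l i) < e"
        using cauchy by blast
      have "dist (a k i) (a l i) < e" if "N \<le> k" "N \<le> l" for k l
        using N[OF that] abs_le_list_norm[OF diff_in[of k l], of i] by (simp add: dist_real_def)
      then show "\<exists>M. \<forall>k\<ge>M. \<forall>l\<ge>M. dist (a k i) (a l i) < e"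
        by blast
    qed
    then have "\<exists>b. (\<lambda>k. a k i) \<longlonglongrightarrow> b" for i
      by (simp add: Cauchy_convergent_iff convergent_def)
    then obtain b where b: "\<And>i. (\<lambda>k. a k i) \<longlonglongrightarrow> b i"
      by metis
    have close: "\<exists>N. \<forall>k\<ge>N. \<forall>E\<in>H. sum_over (\<lambda>i. \<bar>a k i - b i\<bar>) E \<le> e" if e: "0 < e" for e
    proof -
      obtain N where N: "\<And>k l. N \<le> k \<Longrightarrow> N \<le> l \<Longrightarrow> list_norm H (\<lambda>i. a k i - a l i) < e"
        using cauchy[OF e] by blast
      have "sum_over (\<lambda>i. \<bar>a k i - b i\<bar>) E \<le> e" if "N \<le> k" "E \<in> H" for k E
      proof (rule LIMSEQ_le_const2)
        show "(\<lambda>l. sum_over (\<lambda>i. \<bar>a k i - a l i\<bar>) E) \<longlonglongrightarrow> sum_over (\<lambda>i. \<bar>a k i - b i\<bar>) E"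
          by (intro tendsto_sum_over tendsto_rabs tendsto_diff tendsto_const b)
        have "sum_over (\<lambda>i. \<bar>a k i - a l i\<bar>) E \<le> e" if "N \<le> l" for l
          using sum_over_le_list_norm[OF diff_in \<open>E \<in> H\<close>, of k l] N[OF \<open>N \<le> k\<close> that] by linarith
        then show "\<exists>N. \<forall>l\<ge>N. sum_over (\<lambda>i. \<bar>a k i - a l i\<bar>) E \<le> e"
          by blast
      qed
      then show ?thesis
        by blast
    qed
    have "b \<longlonglongrightarrow> 0"
    proof (rule LIMSEQ_I)
      fix e :: real assume e: "0 < e"
      obtain N where N: "\<And>k E. N \<le> k \<Longrightarrow> E \<in> H \<Longrightarrow> sum_over (\<lambda>i. \<bar>a k i - b i\<bar>) E \<le> e / 2"
        using close[of "e / 2"] e by auto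
      have "a N \<longlonglongrightarrow> 0"
        using a(2) by (simp add: null_sequences_def)
      then obtain M where M: "\<And>i. M \<le> i \<Longrightarrow> \<bar>a N i\<bar> < e / 2"
        using LIMSEQ_D[of "a N" 0 "e / 2"] e by auto
      have "norm (b i - 0) < e" if "M \<le> i" for i
      proof -
        have "\<bar>a N i - b i\<bar> \<le> e / 2"
          using N[OF order_refl singletons, of i] by simp
        then show ?thesis
          using M[OF that] unfolding real_norm_def by linarith
      qed
      then show "\<exists>M. \<forall>i\<ge>M. norm (b i - 0) < e"
        by blast
    qed
    have b_diff: "(\<lambda>i. a k i - b i) \<longlonglongrightarrow> 0" for k
      using tendsto_diff[OF _ \<open>b \<longlonglongrightarrow> 0\<close>, of "a k" 0] a(2)[of k] by (simp add: null_sequences_def)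
    obtain N where "\<And>E. E \<in> H \<Longrightarrow> sum_over (\<lambda>i. \<bar>a N i - b i\<bar>) E \<le> 1"
      using close[of 1] by auto
    then have "(\<lambda>i. a N i - b i) \<in> null_sequences H"
      by (rule null_sequencesI[OF b_diff])
    from null_sequences_add[OF a(2)[of N] null_sequences_scale[OF this, of "- 1"]]
    have b_in: "b \<in> null_sequences H"
      by simp
    have "(\<lambda>k. vnorm ?B (\<sigma> k \<ominus>\<^bsub>?B\<^esub> \<iota> b)) \<longlonglongrightarrow> 0"
    proof (rule LIMSEQ_I)
      fix e :: real assume e: "0 < e"
      obtain N where N: "\<And>k E. N \<le> k \<Longrightarrow> E \<in> H \<Longrightarrow> sum_over (\<lambda>i. \<bar>a k i - b i\<bar>) E \<le> e / 2"
        using close[of "e / 2"] e by auto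
      have "norm (vnorm ?B (\<sigma> k \<ominus>\<^bsub>?B\<^esub> \<iota> b) - 0) < e" if "N \<le> k" for k
      proof -
        have "list_norm H (\<lambda>i. a k i - b i) \<le> e / 2"
          by (rule list_norm_le) (rule N[OF that])
        then have "vnorm ?B (\<sigma> k \<ominus>\<^bsub>?B\<^esub> \<iota> b) \<le> e / 2"
          using a b_in by (simp add: sequence_space_diff)
        moreover have "0 \<le> vnorm ?B (\<sigma> k \<ominus>\<^bsub>?B\<^esub> \<iota> b)"
          using a b_in by (intro vnorm_nonneg M.minus_closed) auto
        ultimately show ?thesis
          using e by simp
      qed
      then show "\<exists>N. \<forall>k\<ge>N. norm (vnorm ?B (\<sigma> k \<ominus>\<^bsub>?B\<^esub> \<iota> b) - 0) < e"
        by blast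
    qed
    then have "limitin (norm_topology ?B) \<sigma> (\<iota> b) sequentially"
      using b_in range by (subst limitin_norm_topology[OF normed_vector_space_sequence_space]) auto
    then show ?thesis
      by (auto simp: norm_topology_def)
  qed
  then have "mcomplete"
    unfolding mcomplete_def by blast
  then show ?thesis
    by (intro banach_space.intro normed_vector_space_sequence_space banach_space_axioms.intro)
qed

lemma operator_coordinate: "operator (sequence_space \<iota> H) type_space (\<lambda>u. inv_into UNIV \<iota> u k)"
  using inj abs_le_list_norm by (auto simp: operator_def intro!: exI[of _ 1])

lemma unit_null_sequences: "unit_sequence n \<in> null_sequences H"
  by (rule finite_support_null_sequences[of n]) (simp add: unit_sequence_def)

text \<open>
  The norm does not see signs. So a functional that is at least \<open>e\<close> in absolute value at infinitely many
  unit vectors is, after a change of signs, at least \<open>e\<close> on all convex combinations of these;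
  negligibility provides combinations of arbitrarily small norm.
\<close>

lemma weakly_null_unit_sequences:
  assumes "negligible H"
  shows "weakly_converges (sequence_space \<iota> H) (\<lambda>n. \<iota> (unit_sequence n)) (\<iota> (\<lambda>_. 0))"
  unfolding weakly_converges_def
proof (intro conjI allI impI)
  let ?B = "sequence_space \<iota> H"
  fix \<phi> :: "'u \<Rightarrow> real" assume \<phi>: "operator ?B type_space \<phi>"
  have \<phi>_add: "\<phi> (\<iota> (\<lambda>n. a n + b n)) = \<phi> (\<iota> a) + \<phi> (\<iota> b)"
    if "a \<in> null_sequences H" "b \<in> null_sequences H" for a b
    using \<phi> that by (simp add: operator_def)
  have \<phi>_scale: "\<phi> (\<iota> (\<lambda>n. t * a n)) = t * \<phi> (\<iota> a)" if "a \<in> null_sequences H" for t a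
    using \<phi> that by (simp add: operator_def)
  obtain K where "\<And>u. u \<in> carrier ?B \<Longrightarrow> vnorm (type_space :: real normed_structure) (\<phi> u) \<le> K * vnorm ?B u"
    using \<phi> unfolding operator_def by blast
  then have K: "\<bar>\<phi> (\<iota> a)\<bar> \<le> K * list_norm H a" if "a \<in> null_sequences H" for a
    using that by force
  show "(\<lambda>n. \<phi> (\<iota> (unit_sequence n))) \<longlonglongrightarrow> \<phi> (\<iota> (\<lambda>_. 0))"
  proof (rule ccontr)
    assume "\<not> ?thesis"
    moreover have "\<phi> (\<iota> (\<lambda>_. 0)) = 0"
      using \<phi>_scale[OF zero_null_sequences, of 0] by simp
    ultimately obtain e where e: "0 < e" "\<And>s. \<exists>n\<ge>s. e \<le> \<bar>\<phi> (\<iota> (unit_sequence n))\<bar>"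
      by (auto simp: LIMSEQ_iff not_less)
    define \<sigma> where "\<sigma> n = (if \<phi> (\<iota> (unit_sequence n)) < 0 then - 1 else 1 :: real)" for n
    define D where "D = {d. (\<forall>n. 0 \<le> d n) \<and> (\<exists>s. \<forall>n>s. d n = 0) \<and>
      (\<forall>E. increasing E \<longrightarrow> sum_over d E \<le> 1) \<and> e \<le> \<phi> (\<iota> (\<lambda>n. \<sigma> n * d n))}"
    have D_in: "(\<lambda>n. \<sigma> n * d n) \<in> null_sequences H" if d: "d \<in> D" for d
    proof -
      obtain s where "\<And>n. s < n \<Longrightarrow> d n = 0"
        using d by (auto simp: D_def)
      then show ?thesis
        by (intro finite_support_null_sequences[of s]) simp
    qed
    have "tail_convex D"
    proof (rule tail_convexI)
      fix d d' and t :: real assume d: "d \<in> D" "d' \<in> D" and t: "0 \<le> t" "t \<le> 1"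
      let ?d = "\<lambda>n. (1 - t) * d n + t * d' n"
      obtain s s' where "\<And>n. s < n \<Longrightarrow> d n = 0" "\<And>n. s' < n \<Longrightarrow> d' n = 0"
        using d by (auto simp: D_def)
      then have "\<forall>n>max s s'. ?d n = 0"
        by simp
      moreover have "sum_over ?d E \<le> 1" if "increasing E" for E
        unfolding sum_over_convex
        using convex_bound_le[of "sum_over d E" 1 "sum_over d' E" "1 - t" t] d t that
        by (simp add: D_def)
      moreover have "e \<le> \<phi> (\<iota> (\<lambda>n. \<sigma> n * ?d n))"
      proof -
        have "(\<lambda>n. \<sigma> n * ?d n) = (\<lambda>n. (1 - t) * (\<sigma> n * d n) + t * (\<sigma> n * d' n))"
          by (simp add: algebra_simps)
        then have "\<phi> (\<iota> (\<lambda>n. \<sigma> n * ?d n)) =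
            (1 - t) * \<phi> (\<iota> (\<lambda>n. \<sigma> n * d n)) + t * \<phi> (\<iota> (\<lambda>n. \<sigma> n * d' n))"
          using \<phi>_add[OF null_sequences_scale[OF D_in[OF d(1)]] null_sequences_scale[OF D_in[OF d(2)]]]
            \<phi>_scale[OF D_in[OF d(1)]] \<phi>_scale[OF D_in[OF d(2)]] by simp
        moreover have "(1 - t) * e \<le> (1 - t) * \<phi> (\<iota> (\<lambda>n. \<sigma> n * d n))"
          "t * e \<le> t * \<phi> (\<iota> (\<lambda>n. \<sigma> n * d' n))"
          using d t by (auto simp: D_def intro: mult_left_mono)
        ultimately show ?thesis
          by (simp add: algebra_simps)
      qed
      moreover have "0 \<le> ?d n" for n
        using d t by (simp add: D_def)
      ultimately show "?d \<in> D"
        unfolding D_def by blast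
    next
      fix s
      obtain n where n: "Suc s \<le> n" "e \<le> \<bar>\<phi> (\<iota> (unit_sequence n))\<bar>"
        using e(2) by blast
      have "(\<lambda>k. \<sigma> k * unit_sequence n k) = (\<lambda>k. \<sigma> n * unit_sequence n k)"
        by (simp add: unit_sequence_def fun_eq_iff)
      then have "e \<le> \<phi> (\<iota> (\<lambda>k. \<sigma> k * unit_sequence n k))"
        using \<phi>_scale[OF unit_null_sequences, of "\<sigma> n" n] n(2) by (simp add: \<sigma>_def split: if_splits)
      moreover have "sum_over (unit_sequence n) E \<le> 1" if "increasing E" for E
        using sum_over_le_sum[OF that, of "unit_sequence n" n] by (simp add: unit_sequence_def)
      ultimately have "unit_sequence n \<in> D"
        unfolding D_def by (auto simp: unit_sequence_def)
      then show "\<exists>d\<in>D. \<forall>n\<le>s. d n = 0"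
        using n(1) by (intro bexI[of _ "unit_sequence n"]) (auto simp: unit_sequence_def)
    qed (auto simp: D_def)
    moreover have "0 < e / (2 * (\<bar>K\<bar> + 1))"
      using e(1) by (simp add: add_nonneg_pos)
    ultimately obtain d where d: "d \<in> D"
      "\<And>E. E \<in> H \<Longrightarrow> sum_over d E \<le> e / (2 * (\<bar>K\<bar> + 1))"
      using negligibleE[OF assms] by blast
    have "\<bar>\<sigma> n * d n\<bar> = d n" for n
      using d(1) by (simp add: D_def \<sigma>_def)
    then have small: "list_norm H (\<lambda>n. \<sigma> n * d n) \<le> e / (2 * (\<bar>K\<bar> + 1))"
      using d(2) by (intro list_norm_le) simp
    have "e \<le> \<phi> (\<iota> (\<lambda>n. \<sigma> n * d n))"
      using d(1) by (simp add: D_def)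
    then have "e \<le> K * list_norm H (\<lambda>n. \<sigma> n * d n)"
      using K[OF D_in[OF d(1)]] by linarith
    also have "\<dots> \<le> (\<bar>K\<bar> + 1) * list_norm H (\<lambda>n. \<sigma> n * d n)"
      using abs_le_list_norm[OF D_in[OF d(1)], of 0] by (intro mult_right_mono) auto
    also have "\<dots> \<le> (\<bar>K\<bar> + 1) * (e / (2 * (\<bar>K\<bar> + 1)))"
      using small by (intro mult_left_mono) auto
    also have "\<dots> = e / 2"
      by (simp add: field_simps)
    finally show False
      using e(1) by simp
  qed
qed (auto simp: unit_null_sequences zero_null_sequences)

end

abbreviation singleton_lists :: "nat list set"
  where "singleton_lists \<equiv> range (\<lambda>n. [n])"

text \<open>
  The unit vectors are weakly null in the domain and have mutual distance 1 in \<open>c\<^sub>0\<close>.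
\<close>

lemma identity_into_sup_norm_non_completely_continuous:
  assumes inj: "inj \<iota>" and singletons: "\<And>n. [n] \<in> H" and incr: "\<And>E. E \<in> H \<Longrightarrow> increasing E"
    and negl: "negligible H"
  shows "non_completely_continuous (sequence_space \<iota> H) (sequence_space \<iota> singleton_lists) id"
proof -
  let ?V = "sequence_space \<iota> H" and ?W = "sequence_space \<iota> singleton_lists"
  have S: "[n] \<in> singleton_lists" "E \<in> singleton_lists \<Longrightarrow> increasing E" for n E
    by auto
  note V = sequence_space_simps[OF inj singletons incr] and W = sequence_space_simps[OF inj S]
  have sub: "a \<in> null_sequences singleton_lists" if "a \<in> null_sequences H" for a
    using abs_le_list_norm[OF inj singletons incr that] that
    by (intro null_sequencesI[OF inj S, of _ "list_norm H a"]) (auto simp: null_sequences_def)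
  have "operator ?V ?W id"
    unfolding operator_def
  proof (intro conjI exI[of _ 1] ballI)
    fix u assume "u \<in> carrier ?V"
    then obtain a where a: "u = \<iota> a" "a \<in> null_sequences H"
      by (auto simp: V)
    have "list_norm singleton_lists a \<le> list_norm H a"
      by (rule list_norm_le[OF inj S]) (use abs_le_list_norm[OF inj singletons incr a(2)] in auto)
    then show "vnorm ?W (id u) \<le> 1 * vnorm ?V u"
      using a by (simp add: V W)
  qed (use sub in \<open>auto simp: V W\<close>)
  moreover have "\<not> limitin (norm_topology ?W) (\<lambda>n. \<iota> (unit_sequence n)) m sequentially" for m
  proof
    assume lim: "limitin (norm_topology ?W) (\<lambda>n. \<iota> (unit_sequence n)) m sequentially"
    interpret W: normed_vector_space ?W
      by (rule normed_vector_space_sequence_space[OF inj S])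
    interpret WM: Metric_space "carrier ?W" "vdist ?W"
      by (rule W.Metric_space_vdist)
    have "m \<in> carrier ?W"
      using lim unfolding norm_topology_def by (simp add: WM.limitin_metric)
    then obtain a where a: "m = \<iota> a" "a \<in> null_sequences singleton_lists"
      by (auto simp: W)
    have unit: "unit_sequence n \<in> null_sequences singleton_lists" for n
      by (rule unit_null_sequences[OF inj S])
    have lim0: "(\<lambda>n. list_norm singleton_lists (\<lambda>k. unit_sequence n k - a k)) \<longlonglongrightarrow> 0"
      using lim a unit W.normed_vector_space_axioms
      by (subst (asm) limitin_norm_topology) (auto simp: W sequence_space_diff[OF inj S])
    have diff: "(\<lambda>k. unit_sequence n k - a k) \<in> null_sequences singleton_lists" for n
      using null_sequences_add[OF inj S unit null_sequences_scale[OF inj S a(2), of "- 1"]] by simp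
    have coord: "(\<lambda>n. \<bar>unit_sequence n k - a k\<bar>) \<longlonglongrightarrow> 0" for k
      by (rule tendsto_sandwich[OF _ _ tendsto_const lim0])
        (auto intro!: always_eventually abs_le_list_norm[OF inj S diff])
    have "a k = 0" for k
    proof -
      have "(\<lambda>n. \<bar>unit_sequence n k - a k\<bar>) \<longlonglongrightarrow> \<bar>0 - a k\<bar>"
        by (intro tendsto_eventually eventually_sequentiallyI[of "Suc k"]) (simp add: unit_sequence_def)
      then show ?thesis
        using LIMSEQ_unique[OF coord] by fastforce
    qed
    then have "1 \<le> list_norm singleton_lists (\<lambda>k. unit_sequence n k - a k)" for n
      using abs_le_list_norm[OF inj S diff, of n n] by (simp add: unit_sequence_def)
    then show False
      using LIMSEQ_le_const[OF lim0, of 1] by auto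
  qed
  moreover have "\<exists>l. weakly_converges ?V (\<lambda>n. \<iota> (unit_sequence n)) l"
    using weakly_null_unit_sequences[OF inj singletons incr negl] by blast
  ultimately have "\<not> completely_continuous ?V ?W id" "operator ?V ?W id"
    unfolding completely_continuous_def id_apply by blast+
  then show ?thesis
    unfolding non_completely_continuous_def
    by (intro conjI banach_space_sequence_space[OF inj singletons incr]
        banach_space_sequence_space[OF inj S])
qed

section \<open>The tree of lower estimates of a weakly null sequence\<close>

context normed_vector_space
begin

text \<open>
  The index lists over which \<open>y\<close> dominates the unit vector basis of \<open>l\<^sub>1\<close> on
  nonnegative coefficients. They form a tree under initial segments. Its rank measures how close \<open>y\<close>
  comes to having a subsequence with such an estimate.
\<close>

definition l1_lists :: "(nat \<Rightarrow> 'a) \<Rightarrow> real \<Rightarrow> nat list set"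
  where "l1_lists y c = {is. increasing is \<and>
    (\<forall>a. (\<forall>i. 0 \<le> a i) \<longrightarrow> c * sum_over a is \<le> vnorm X (lincomb y a is))}"

lemma l1_lists_append:
  assumes y: "range y \<subseteq> carrier X" and in_l1: "is @ js \<in> l1_lists y c"
  shows "is \<in> l1_lists y c" "js \<in> l1_lists y c"
proof -
  have incr: "increasing is" "increasing js" and disj: "set is \<inter> set js = {}"
    using in_l1 by (auto simp: l1_lists_def sorted_wrt_append)
  have bound: "c * sum_over a (is @ js) \<le> vnorm X (lincomb y a (is @ js))" if "\<And>i. 0 \<le> a i" for a
    using in_l1 that by (simp add: l1_lists_def)
  have zero: "sum_over a ks = 0" if "\<And>i. i \<in> set ks \<Longrightarrow> a i = 0" for a :: "nat \<Rightarrow> real" and ks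
    using that by (induction ks) auto
  have cong: "sum_over a ks = sum_over b ks" if "\<And>i. i \<in> set ks \<Longrightarrow> a i = b i"
    for a b :: "nat \<Rightarrow> real" and ks
    using that by (induction ks) auto
  show "is \<in> l1_lists y c"
    unfolding l1_lists_def
  proof (intro CollectI conjI incr(1) allI impI)
    fix a :: "nat \<Rightarrow> real" assume a: "\<forall>i. 0 \<le> a i"
    define b where "b i = (if i \<in> set is then a i else 0)" for i
    have "lincomb y b is = lincomb y a is" "sum_over b is = sum_over a is"
      by (auto simp: b_def intro!: lincomb_cong cong)
    moreover have "lincomb y b js = \<zero>" "sum_over b js = 0"
      using disj by (auto simp: b_def intro!: lincomb_eq_zero[OF y] zero)
    ultimately show "c * sum_over a is \<le> vnorm X (lincomb y a is)"
      using bound[of b] a y by (simp add: b_def lincomb_append)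
  qed
  show "js \<in> l1_lists y c"
    unfolding l1_lists_def
  proof (intro CollectI conjI incr(2) allI impI)
    fix a :: "nat \<Rightarrow> real" assume a: "\<forall>i. 0 \<le> a i"
    define b where "b i = (if i \<in> set js then a i else 0)" for i
    have "lincomb y b js = lincomb y a js" "sum_over b js = sum_over a js"
      by (auto simp: b_def intro!: lincomb_cong cong)
    moreover have "lincomb y b is = \<zero>" "sum_over b is = 0"
      using disj by (auto simp: b_def intro!: lincomb_eq_zero[OF y] zero)
    ultimately show "c * sum_over a js \<le> vnorm X (lincomb y a js)"
      using bound[of b] a y by (simp add: b_def lincomb_append)
  qed
qed

text \<open>
  An infinite branch is a subsequence on which some functional stays above \<open>c\<close>.
\<close>

lemma l1_lists_no_branch:
  assumes y: "range y \<subseteq> carrier X"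
    and null: "\<And>f. operator X (type_space :: real normed_structure) f \<Longrightarrow> (\<lambda>n. f (y n)) \<longlonglongrightarrow> 0"
    and c: "0 < c"
  shows "\<nexists>i. \<forall>n. map i [0..<n] \<in> l1_lists y c"
proof
  assume "\<exists>i. \<forall>n. map i [0..<n] \<in> l1_lists y c"
  then obtain i where i: "\<And>n. map i [0..<n] \<in> l1_lists y c"
    by blast
  have "i n < i (Suc n)" for n
    using i[of "Suc (Suc n)"] by (auto simp: l1_lists_def sorted_wrt_append)
  then have mono: "strict_mono i"
    by (simp add: strict_mono_Suc_iff)
  have yi: "range (y \<circ> i) \<subseteq> carrier X"
    using y by auto
  obtain f where f: "operator X type_space f" "\<And>j. c \<le> f ((y \<circ> i) j)"
  proof (rule functional_bounded_below_on_sequence[OF yi])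
    fix a :: "nat \<Rightarrow> real" and n assume a: "\<And>j. 0 \<le> a j"
    define b where "b = a \<circ> inv_into UNIV i"
    have b: "b \<circ> i = a"
      using mono by (simp add: b_def fun_eq_iff strict_mono_imp_inj_on)
    have "c * sum_over b (map i [0..<n]) \<le> vnorm X (lincomb y b (map i [0..<n]))"
      using i[of n] a by (simp add: l1_lists_def b_def)
    moreover have "sum_over b (map i [0..<n]) = (\<Sum>j<n. a j)"
      using b by (simp add: interv_sum_list_conv_sum_set_nat atLeast0LessThan)
    ultimately show "c * (\<Sum>j<n. a j) \<le> vnorm X (lincomb (y \<circ> i) a [0..<n])"
      by (simp add: lincomb_map b)
  qed blast
  have "(\<lambda>n. f (y (i n))) \<longlonglongrightarrow> 0"
    using LIMSEQ_subseq_LIMSEQ[OF null[OF f(1)] mono] by (simp add: comp_def)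
  moreover have "\<exists>N. \<forall>n\<ge>N. c \<le> f (y (i n))"
    using f(2) by simp
  ultimately have "c \<le> 0"
    by (rule LIMSEQ_le_const)
  then show False
    using c by simp
qed

end

section \<open>Operators and weakly null sequences\<close>

lemma operator_zero:
  assumes "normed_vector_space X" "normed_vector_space Y" "operator X Y T"
  shows "T \<zero>\<^bsub>X\<^esub> = \<zero>\<^bsub>Y\<^esub>"
proof -
  interpret X: normed_vector_space X by fact
  interpret Y: normed_vector_space Y by fact
  have T0: "T \<zero>\<^bsub>X\<^esub> \<in> carrier Y"
    using assms(3) by (auto simp: operator_def)
  have "T (0 \<odot>\<^bsub>X\<^esub> \<zero>\<^bsub>X\<^esub>) = 0 \<odot>\<^bsub>Y\<^esub> T \<zero>\<^bsub>X\<^esub>"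
    using assms(3) by (simp add: operator_def)
  then show ?thesis
    using T0 by (simp add: X.scale_zero_right Y.scale_zero_left)
qed

lemma operator_comp:
  assumes Y: "normed_vector_space Y"
    and A: "operator X Y A" and f: "operator Y (type_space :: real normed_structure) f"
  shows "operator X (type_space :: real normed_structure) (\<lambda>x. f (A x))"
proof -
  obtain K where K: "\<And>x. x \<in> carrier X \<Longrightarrow> vnorm Y (A x) \<le> K * vnorm X x"
    using A unfolding operator_def by blast
  obtain L where L: "\<And>v. v \<in> carrier Y \<Longrightarrow> \<bar>f v\<bar> \<le> L * vnorm Y v"
    using f unfolding operator_def type_space_simps real_norm_def by blast
  have A_in: "A x \<in> carrier Y" if "x \<in> carrier X" for x
    using A that by (auto simp: operator_def)
  have "\<bar>f (A x)\<bar> \<le> (\<bar>L\<bar> * K) * vnorm X x" if x: "x \<in> carrier X" for x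
  proof -
    have "\<bar>f (A x)\<bar> \<le> L * vnorm Y (A x)"
      by (rule L[OF A_in[OF x]])
    also have "\<dots> \<le> \<bar>L\<bar> * vnorm Y (A x)"
      by (intro mult_right_mono normed_vector_space.vnorm_nonneg[OF Y] A_in x) simp
    also have "\<dots> \<le> \<bar>L\<bar> * (K * vnorm X x)"
      by (intro mult_left_mono K x) simp
    finally show ?thesis
      by (simp add: mult.assoc)
  qed
  then show ?thesis
    using A f A_in by (auto simp: operator_def)
qed

lemma not_completely_continuous_weakly_null:
  assumes X: "normed_vector_space X" and Z: "normed_vector_space Z"
    and S: "operator X Z S" and not_cc: "\<not> completely_continuous X Z S"
  obtains x :: "nat \<Rightarrow> 'a" and \<delta> where "range x \<subseteq> carrier X"
    "\<And>f. operator X (type_space :: real normed_structure) f \<Longrightarrow> (\<lambda>n. f (x n)) \<longlonglongrightarrow> 0"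
    "0 < \<delta>" "\<And>n. \<delta> \<le> vnorm Z (S (x n))"
proof -
  interpret X: normed_vector_space X by fact
  interpret Z: normed_vector_space Z by fact
  obtain s l where s: "weakly_converges X s l"
    and no_lim: "\<And>m. \<not> limitin (norm_topology Z) (\<lambda>n. S (s n)) m sequentially"
    using S not_cc unfolding completely_continuous_def by blast
  have carr: "range s \<subseteq> carrier X" "l \<in> carrier X"
    using s by (auto simp: weakly_converges_def)
  have s_in: "s n \<in> carrier X" for n
    using carr by auto
  have S_in: "S u \<in> carrier Z" if "u \<in> carrier X" for u
    using S that by (auto simp: operator_def)
  have S_diff: "S (u \<ominus>\<^bsub>X\<^esub> v) = S u \<ominus>\<^bsub>Z\<^esub> S v" if "u \<in> carrier X" "v \<in> carrier X" for u v
    using S that S_in by (simp add: operator_def X.diff_eq_scale Z.diff_eq_scale)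
  have "\<not> (\<lambda>n. vnorm Z (S (s n \<ominus>\<^bsub>X\<^esub> l))) \<longlonglongrightarrow> 0"
    using no_lim[of "S l"] limitin_norm_topology[OF Z, of "\<lambda>n. S (s n)" "S l"] S_in s_in carr(2)
    by (auto simp: S_diff)
  then obtain \<delta> where \<delta>: "0 < \<delta>" "\<And>N. \<exists>n\<ge>N. \<delta> \<le> \<bar>vnorm Z (S (s n \<ominus>\<^bsub>X\<^esub> l))\<bar>"
    by (auto simp: LIMSEQ_iff not_less)
  have "infinite {n. \<delta> \<le> \<bar>vnorm Z (S (s n \<ominus>\<^bsub>X\<^esub> l))\<bar>}"
    unfolding infinite_nat_iff_unbounded_le mem_Collect_eq by (intro allI \<delta>(2))
  from infinite_enumerate[OF this] obtain r :: "nat \<Rightarrow> nat" where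
    r: "strict_mono r" "\<forall>n. r n \<in> {n. \<delta> \<le> \<bar>vnorm Z (S (s n \<ominus>\<^bsub>X\<^esub> l))\<bar>}"
    by blast
  show thesis
  proof
    show "range (\<lambda>n. s (r n) \<ominus>\<^bsub>X\<^esub> l) \<subseteq> carrier X"
      using s_in carr(2) by auto
    show "0 < \<delta>" by fact
    show "\<delta> \<le> vnorm Z (S (s (r n) \<ominus>\<^bsub>X\<^esub> l))" for n
      using spec[OF r(2), of n] Z.vnorm_nonneg[OF S_in, of "s (r n) \<ominus>\<^bsub>X\<^esub> l"] s_in carr(2) by simp
  next
    fix f assume f: "operator X (type_space :: real normed_structure) f"
    then have "(\<lambda>n. f (s n) - f l) \<longlonglongrightarrow> 0"
      using s by (simp add: weakly_converges_def LIM_zero_iff)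
    moreover have "f (s n \<ominus>\<^bsub>X\<^esub> l) = f (s n) - f l" for n
      using f s_in carr(2) by (simp add: operator_def X.diff_eq_scale)
    ultimately have "(\<lambda>n. f (s n \<ominus>\<^bsub>X\<^esub> l)) \<longlonglongrightarrow> 0"
      by simp
    then show "(\<lambda>n. f (s (r n) \<ominus>\<^bsub>X\<^esub> l)) \<longlonglongrightarrow> 0"
      using LIMSEQ_subseq_LIMSEQ r(1) by (fastforce simp: comp_def)
  qed
qed

text \<open>
  A sequence of reals is determined by the rational cuts of its entries, hence by a set of natural numbers. Together
  with a line in a nonzero space this embeds all real sequences into its type.
\<close>

lemma inj_real_sequences_into_reals: "\<exists>g :: (nat \<Rightarrow> real) \<Rightarrow> real. inj g"
proof -
  define cut where "cut a = {to_nat (n, q) | (n :: nat) (q :: rat). of_rat q < a n}"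
    for a :: "nat \<Rightarrow> real"
  have "inj cut"
  proof (rule injI)
    fix a b assume eq: "cut a = cut b"
    have mem: "to_nat (n, q) \<in> cut c \<longleftrightarrow> of_rat q < c n" for n and q :: rat and c
      by (auto simp: cut_def)
    have "\<not> a n < b n" "\<not> b n < a n" for n
      using of_rat_dense[of "a n" "b n"] of_rat_dense[of "b n" "a n"] mem[of n _ a] mem[of n _ b] eq
      by (metis not_less_iff_gr_or_eq)+
    then show "a = b"
      by (meson ext linorder_less_linear)
  qed
  moreover obtain h :: "nat set \<Rightarrow> real" where "inj h"
    using nat_sets_eqpoll_reals by (auto simp: eqpoll_def bij_betw_def)
  ultimately show ?thesis
    using inj_compose by blast
qed

section \<open>The test operator does not factor the given one\<close>

text \<open>
  Gliding hump. Late rows are small on any finite set of columns, early rows are small in late columns, so the large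
  entry of a late row sits in a late column. The condition \<open>m r \<le> k (Suc r)\<close> prepares for shifting
  lists to the right, and the bound for the entries in column \<open>k s\<close> is summable in \<open>s\<close>.
\<close>

lemma almost_diagonal_subsequences:
  fixes \<alpha> :: "nat \<Rightarrow> nat \<Rightarrow> real"
  assumes rows: "\<And>m. \<alpha> m \<longlonglongrightarrow> 0" and columns: "\<And>k. (\<lambda>m. \<alpha> m k) \<longlonglongrightarrow> 0"
    and \<delta>: "0 < \<delta>" and large: "\<And>m. \<exists>k. \<delta> \<le> \<bar>\<alpha> m k\<bar>"
  obtains m k :: "nat \<Rightarrow> nat" where "strict_mono m" "strict_mono k" "N \<le> k 0"
    "\<And>r. m r \<le> k (Suc r)" "\<And>r. \<delta> \<le> \<bar>\<alpha> (m r) (k r)\<bar>"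
    "\<And>r s. r \<noteq> s \<Longrightarrow> \<bar>\<alpha> (m r) (k s)\<bar> \<le> \<delta> / 4 * (1 / 2) ^ s"
proof -
  have choose: "\<exists>m\<ge>M. \<exists>k\<ge>M. \<delta> \<le> \<bar>\<alpha> m k\<bar> \<and> (\<forall>k'\<le>M. \<bar>\<alpha> m k'\<bar> < e) \<and> (\<forall>m'\<le>M. \<bar>\<alpha> m' k\<bar> < e)"
    if e: "0 < e" for M e
  proof -
    have "eventually (\<lambda>m. \<forall>k\<in>{..M}. \<bar>\<alpha> m k\<bar> < min e \<delta>) sequentially" for M
      using tendstoD[OF columns, of "min e \<delta>"] e \<delta> by (intro eventually_ball_finite) auto
    moreover have "eventually (\<lambda>k. \<forall>m\<in>{..M}. \<bar>\<alpha> m k\<bar> < e) sequentially"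
      using tendstoD[OF rows, of e] e by (intro eventually_ball_finite) auto
    ultimately obtain N L where N: "\<And>k m. N \<le> k \<Longrightarrow> m \<le> M \<Longrightarrow> \<bar>\<alpha> m k\<bar> < e"
      and L: "\<And>m k. L \<le> m \<Longrightarrow> k \<le> max M N \<Longrightarrow> \<bar>\<alpha> m k\<bar> < min e \<delta>"
      unfolding eventually_sequentially by (metis atMost_iff)
    obtain k where k: "\<delta> \<le> \<bar>\<alpha> (max L M) k\<bar>"
      using large by blast
    \<comment> \<open>the row has no entry of size \<open>\<delta>\<close> in the columns up to \<open>max M N\<close>\<close>
    have "max M N < k"
      using L[of "max L M" k] k by fastforce
    then show ?thesis
      using k N L[of "max L M"] by (intro exI[of _ "max L M"] exI[of _ k] conjI) auto
  qed
  have "\<exists>f. \<forall>r. (N \<le> snd (f r) \<and> \<delta> \<le> \<bar>\<alpha> (fst (f r)) (snd (f r))\<bar>) \<and>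
    (fst (f r) < fst (f (Suc r)) \<and> snd (f r) < snd (f (Suc r)) \<and> fst (f r) \<le> snd (f (Suc r)) \<and>
     (\<forall>k'\<le>snd (f r). \<bar>\<alpha> (fst (f (Suc r))) k'\<bar> \<le> \<delta> / 4 * (1 / 2) ^ r) \<and>
     (\<forall>m'\<le>fst (f r). \<bar>\<alpha> m' (snd (f (Suc r)))\<bar> \<le> \<delta> / 4 * (1 / 2) ^ Suc r))"
  proof (rule dependent_nat_choice)
    show "\<exists>p. N \<le> snd p \<and> \<delta> \<le> \<bar>\<alpha> (fst p) (snd p)\<bar>"
      using choose[of \<delta> N] \<delta> by auto
  next
    fix p :: "nat \<times> nat" and r :: nat
    let ?M = "Suc (max N (max (fst p) (snd p)))"
    obtain m k where mk: "?M \<le> m" "?M \<le> k" "\<delta> \<le> \<bar>\<alpha> m k\<bar>"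
      "\<And>k'. k' \<le> ?M \<Longrightarrow> \<bar>\<alpha> m k'\<bar> < \<delta> / 4 * (1 / 2) ^ Suc r"
      "\<And>m'. m' \<le> ?M \<Longrightarrow> \<bar>\<alpha> m' k\<bar> < \<delta> / 4 * (1 / 2) ^ Suc r"
      using choose[of "\<delta> / 4 * (1 / 2) ^ Suc r" ?M] \<delta> by auto
    have "\<delta> / 4 * (1 / 2) ^ Suc r \<le> \<delta> / 4 * (1 / 2) ^ r"
      using \<delta> by simp
    then have "\<bar>\<alpha> m k'\<bar> \<le> \<delta> / 4 * (1 / 2) ^ r" if "k' \<le> snd p" for k'
      using mk(4)[of k'] that by linarith
    moreover have "\<bar>\<alpha> m' k\<bar> \<le> \<delta> / 4 * (1 / 2) ^ Suc r" if "m' \<le> fst p" for m'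
      using mk(5)[of m'] that by linarith
    ultimately show "\<exists>q. (N \<le> snd q \<and> \<delta> \<le> \<bar>\<alpha> (fst q) (snd q)\<bar>) \<and>
      (fst p < fst q \<and> snd p < snd q \<and> fst p \<le> snd q \<and>
       (\<forall>k'\<le>snd p. \<bar>\<alpha> (fst q) k'\<bar> \<le> \<delta> / 4 * (1 / 2) ^ r) \<and>
       (\<forall>m'\<le>fst p. \<bar>\<alpha> m' (snd q)\<bar> \<le> \<delta> / 4 * (1 / 2) ^ Suc r))"
      using mk(1-3) by (intro exI[of _ "(m, k)"]) auto
  qed
  then obtain f where f: "\<And>r. N \<le> snd (f r)" "\<And>r. \<delta> \<le> \<bar>\<alpha> (fst (f r)) (snd (f r))\<bar>"
    "\<And>r. fst (f r) < fst (f (Suc r))" "\<And>r. snd (f r) < snd (f (Suc r))"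
    "\<And>r. fst (f r) \<le> snd (f (Suc r))"
    "\<And>r k'. k' \<le> snd (f r) \<Longrightarrow> \<bar>\<alpha> (fst (f (Suc r))) k'\<bar> \<le> \<delta> / 4 * (1 / 2) ^ r"
    "\<And>r m'. m' \<le> fst (f r) \<Longrightarrow> \<bar>\<alpha> m' (snd (f (Suc r)))\<bar> \<le> \<delta> / 4 * (1 / 2) ^ Suc r"
    by auto
  define m k where "m = fst \<circ> f" and "k = snd \<circ> f"
  have mono: "strict_mono m" "strict_mono k"
    using f by (auto simp: m_def k_def strict_mono_Suc_iff)
  have mono_le: "m r \<le> m s" "k r \<le> k s" if "r \<le> s" for r s
    using mono that by (auto simp: strict_mono_less_eq)
  show thesis
  proof (rule that[OF mono])
    fix r s :: nat assume "r \<noteq> s"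
    then consider s' where "s = Suc s'" "r \<le> s'" | r' where "r = Suc r'" "s \<le> r'"
      by (metis linorder_neqE_nat less_Suc_eq_le not0_implies_Suc not_less0)
    then show "\<bar>\<alpha> (m r) (k s)\<bar> \<le> \<delta> / 4 * (1 / 2) ^ s"
    proof cases
      case 1
      then show ?thesis
        using f(7)[of "m r" s'] mono_le(1)[of r s'] by (simp add: m_def k_def)
    next
      case 2
      have "(1 / 2 :: real) ^ r' \<le> (1 / 2) ^ s"
        using 2 by (intro power_decreasing) auto
      then have "\<delta> / 4 * (1 / 2) ^ r' \<le> \<delta> / 4 * (1 / 2) ^ s"
        using \<delta> by (intro mult_left_mono) auto
      then show ?thesis
        using 2 f(6)[of "k s" r'] mono_le(2)[of s r'] by (simp add: m_def k_def)
    qed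
  qed (use f in \<open>auto simp: m_def k_def\<close>)
qed

text \<open>
  The off-diagonal part of column \<open>s\<close> is at most \<open>\<delta> / 4 * (1 / 2) ^ s\<close> times the sum
  of the coefficients, altogether at most half of what the diagonal contributes.
\<close>

lemma diagonal_dominance:
  fixes \<beta> :: "nat \<Rightarrow> nat \<Rightarrow> real"
  assumes diag: "\<And>r. \<delta> \<le> \<bar>\<beta> r r\<bar>"
    and off: "\<And>r s. r \<noteq> s \<Longrightarrow> \<bar>\<beta> r s\<bar> \<le> \<delta> / 4 * (1 / 2) ^ s"
    and \<delta>: "0 < \<delta>" and a: "\<And>r. 0 \<le> a r"
  shows "\<delta> / 2 * (\<Sum>r<n. a r) \<le> (\<Sum>s<n. \<bar>\<Sum>r<n. a r * \<beta> r s\<bar>)"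
proof -
  have geom: "(\<Sum>s<n. (1 / 2 :: real) ^ s) \<le> 2" for n
  proof -
    have "(\<Sum>s<n. (1 / 2 :: real) ^ s) = 2 - 2 * (1 / 2) ^ n"
      by (induction n) auto
    then show ?thesis
      by simp
  qed
  have row: "a s * \<delta> - (\<Sum>r<n. a r) * (\<delta> / 4 * (1 / 2) ^ s) \<le> \<bar>\<Sum>r<n. a r * \<beta> r s\<bar>"
    if s: "s < n" for s
  proof -
    have "(\<Sum>r<n. a r * \<beta> r s) = a s * \<beta> s s + (\<Sum>r\<in>{..<n} - {s}. a r * \<beta> r s)"
      using s by (intro sum.remove) auto
    moreover have "\<bar>a r * \<beta> r s\<bar> \<le> a r * (\<delta> / 4 * (1 / 2) ^ s)" if "r \<noteq> s" for r
      using mult_left_mono[OF off[OF that] a[of r]] a[of r] by (simp only: abs_mult abs_of_nonneg)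
    then have "\<bar>\<Sum>r\<in>{..<n} - {s}. a r * \<beta> r s\<bar> \<le>
        (\<Sum>r\<in>{..<n} - {s}. a r * (\<delta> / 4 * (1 / 2) ^ s))"
      by (intro order_trans[OF sum_abs] sum_mono) auto
    moreover have "(\<Sum>r\<in>{..<n} - {s}. a r * (\<delta> / 4 * (1 / 2) ^ s)) \<le>
        (\<Sum>r<n. a r * (\<delta> / 4 * (1 / 2) ^ s))"
      using a \<delta> by (intro sum_mono2) auto
    moreover have "(\<Sum>r<n. a r * (\<delta> / 4 * (1 / 2) ^ s)) = (\<Sum>r<n. a r) * (\<delta> / 4 * (1 / 2) ^ s)"
      by (rule sum_distrib_right[symmetric])
    moreover have "a s * \<delta> \<le> \<bar>a s * \<beta> s s\<bar>"
      using diag a by (simp add: abs_mult mult_left_mono)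
    ultimately show ?thesis
      by linarith
  qed
  have "(\<Sum>r<n. a r) * \<delta> - (\<Sum>r<n. a r) * (\<delta> / 4) * (\<Sum>s<n. (1 / 2) ^ s) =
      (\<Sum>s<n. a s * \<delta> - (\<Sum>r<n. a r) * (\<delta> / 4 * (1 / 2) ^ s))"
    by (simp only: sum_subtractf sum_distrib_right sum_distrib_left mult.assoc)
  also have "\<dots> \<le> (\<Sum>s<n. \<bar>\<Sum>r<n. a r * \<beta> r s\<bar>)"
    using row by (intro sum_mono) auto
  finally have "(\<Sum>r<n. a r) * \<delta> - (\<Sum>r<n. a r) * (\<delta> / 4) * (\<Sum>s<n. (1 / 2) ^ s) \<le>
    (\<Sum>s<n. \<bar>\<Sum>r<n. a r * \<beta> r s\<bar>)" .
  moreover have "(\<Sum>r<n. a r) * (\<delta> / 4) * (\<Sum>s<n. (1 / 2) ^ s) \<le> (\<Sum>r<n. a r) * (\<delta> / 4) * 2"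
    using a \<delta> geom by (intro mult_left_mono mult_nonneg_nonneg sum_nonneg) auto
  ultimately show ?thesis
    by (simp add: algebra_simps)
qed

text \<open>
  The core of the proof. If every \<open>A (x n)\<close> had a coordinate of size \<open>\<delta>\<close>, choose
  almost diagonal rows \<open>m r\<close> and columns \<open>k r\<close>. Whenever \<open>k 0, \<dots>, k n\<close> is
  in \<open>H\<close>, the norm on the sequence space gives a lower \<open>l\<^sub>1\<close> estimate for \<open>x (m
  0), \<dots>, x (m n)\<close> with a constant \<open>c\<close> independent of \<open>n\<close>. Conversely, once
  \<open>m 0, \<dots>, m (n - 1)\<close> satisfies the estimate, the list \<open>k 1, \<dots>, k n\<close> is a spread
  of it, and \<open>k 0, \<dots>, k n\<close> is in \<open>H\<close>. The two implications add one entry after the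
  other to the same list and build an infinite branch.
\<close>

lemma operator_image_uniformly_small_coordinates:
  fixes x :: "nat \<Rightarrow> 'u"
  assumes X: "normed_vector_space X"
    and x: "range x \<subseteq> carrier X"
    and null: "\<And>f. operator X (type_space :: real normed_structure) f \<Longrightarrow> (\<lambda>n. f (x n)) \<longlonglongrightarrow> 0"
    and inj: "inj \<iota>" and singletons: "\<And>n. [n] \<in> H" and incr: "\<And>E. E \<in> H \<Longrightarrow> increasing E"
    and H: "H = diagonal_step (\<lambda>N. spreads (normed_vector_space.l1_lists X x (1 / real (Suc N))))"
    and A: "operator X (sequence_space \<iota> H) A"
    and \<delta>: "0 < \<delta>"
  shows "\<exists>n. \<forall>k. \<bar>inv_into UNIV \<iota> (A (x n)) k\<bar> < \<delta>"
proof (rule ccontr)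
  interpret normed_vector_space X by fact
  let ?V = "sequence_space \<iota> H"
  note V = sequence_space_simps[OF inj singletons incr]
  have normed_V: "normed_vector_space ?V"
    by (rule normed_vector_space_sequence_space[OF inj singletons incr])
  define \<alpha> where "\<alpha> n = inv_into UNIV \<iota> (A (x n))" for n
  assume "\<not> ?thesis"
  then have large: "\<exists>k. \<delta> \<le> \<bar>\<alpha> n k\<bar>" for n
    by (auto simp: \<alpha>_def not_less)
  have x_in: "x n \<in> carrier X" for n
    using x by auto
  have \<alpha>: "A (x n) = \<iota> (\<alpha> n)" "\<alpha> n \<in> null_sequences H" for n
  proof -
    have "A (x n) \<in> \<iota> ` null_sequences H"
      using A x_in[of n] by (auto simp: operator_def V)
    then show "A (x n) = \<iota> (\<alpha> n)" "\<alpha> n \<in> null_sequences H"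
      using inj by (auto simp: \<alpha>_def)
  qed
  have rows: "\<alpha> n \<longlonglongrightarrow> 0" for n
    using \<alpha>(2)[of n] by (simp add: null_sequences_def)
  have columns: "(\<lambda>n. \<alpha> n k) \<longlonglongrightarrow> 0" for k
    unfolding \<alpha>_def
    by (rule null) (rule operator_comp[OF normed_V A operator_coordinate[OF inj singletons incr]])
  have A_lincomb: "A (lincomb x a is) = \<iota> (\<lambda>k. sum_over (\<lambda>i. a i * \<alpha> i k) is) \<and>
      (\<lambda>k. sum_over (\<lambda>i. a i * \<alpha> i k) is) \<in> null_sequences H" for a "is"
  proof (induction "is")
    case Nil
    then show ?case
      using operator_zero[OF X normed_V A] zero_null_sequences[OF inj singletons incr]
      by (simp add: V)
  next
    case (Cons i "is")
    have "A (lincomb x a (i # is)) = a i \<odot>\<^bsub>?V\<^esub> A (x i) \<oplus>\<^bsub>?V\<^esub> A (lincomb x a is)"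
      using A x_in[of i] x by (simp add: operator_def)
    then show ?case
      using Cons \<alpha>[of i]
        null_sequences_add[OF inj singletons incr null_sequences_scale[OF inj singletons incr]]
      by (simp add: V)
  qed
  obtain K0 where K0: "\<And>u. u \<in> carrier X \<Longrightarrow> vnorm ?V (A u) \<le> K0 * vnorm X u"
    using A unfolding operator_def by blast
  define K where "K = \<bar>K0\<bar> + 1"
  have K_pos: "0 < K"
    by (simp add: K_def)
  have "K0 \<le> K"
    unfolding K_def by linarith
  then have K: "vnorm ?V (A u) \<le> K * vnorm X u" if "u \<in> carrier X" for u
    using K0[OF that] mult_right_mono[OF _ vnorm_nonneg[OF that], of K0 K] by linarith
  \<comment> \<open>the estimate obtained from \<open>H\<close> has constant \<open>\<delta> / (2 * K)\<close>, as \<open>diagonal_dominance\<close> costs a factor 2\<close>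
  obtain N where N: "1 / real (Suc N) < \<delta> / (2 * K)"
    using reals_Archimedean[of "\<delta> / (2 * K)"] \<delta> K_pos by (auto simp: inverse_eq_divide)
  obtain m k where mk: "strict_mono m" "strict_mono k" "N \<le> k 0" "\<And>r. m r \<le> k (Suc r)"
    "\<And>r. \<delta> \<le> \<bar>\<alpha> (m r) (k r)\<bar>"
    "\<And>r s. r \<noteq> s \<Longrightarrow> \<bar>\<alpha> (m r) (k s)\<bar> \<le> \<delta> / 4 * (1 / 2) ^ s"
    by (rule almost_diagonal_subsequences[where N = N, OF rows columns \<delta> large]) blast
  have increasing_map: "increasing (map f [0..<n])" if "strict_mono f" for f n
    using that by (auto simp: sorted_wrt_iff_nth_less strict_mono_less)
  have "map m [0..<n] \<in> l1_lists x (1 / real (Suc N))" for n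
  proof (induction n)
    case 0
    then show ?case
      by (simp add: l1_lists_def vnorm_nonneg)
  next
    case (Suc n)
    let ?E = "map k [0..<Suc n]"
    have E: "?E = k 0 # map (k \<circ> Suc) [0..<n]"
      by (simp add: upt_conv_Cons map_Suc_upt[symmetric] del: upt_Suc)
    have "map (k \<circ> Suc) [0..<n] \<in> spreads (l1_lists x (1 / real (Suc N)))"
      unfolding spreads_def
    proof (intro CollectI conjI bexI[OF _ Suc])
      show "increasing (map (k \<circ> Suc) [0..<n])"
        using mk(2) by (intro increasing_map) (auto simp: strict_mono_def)
      show "list_all2 (\<le>) (map m [0..<n]) (map (k \<circ> Suc) [0..<n])"
        using mk(4) by (simp add: list_all2_conv_all_nth)
    qed
    then have "k 0 # map (k \<circ> Suc) [0..<n] \<in> H"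
      using mk(3) increasing_map[OF mk(2), of "Suc n"] unfolding H diagonal_step_def E by blast
    then have E_in: "?E \<in> H"
      unfolding E .
    show ?case
      unfolding l1_lists_def
    proof (intro CollectI conjI increasing_map mk(1) allI impI)
      fix a :: "nat \<Rightarrow> real" assume a: "\<forall>i. 0 \<le> a i"
      let ?u = "lincomb x a (map m [0..<Suc n])"
      let ?c = "\<lambda>k. sum_over (\<lambda>i. a i * \<alpha> i k) (map m [0..<Suc n])"
      have sum_map: "sum_over f (map g [0..<Suc n]) = (\<Sum>r<Suc n. f (g r))"
        for f :: "nat \<Rightarrow> real" and g
        by (simp add: interv_sum_list_conv_sum_set_nat atLeast0LessThan comp_def del: upt_Suc)
      have "\<delta> / 2 * (\<Sum>r<Suc n. a (m r)) \<le> (\<Sum>s<Suc n. \<bar>\<Sum>r<Suc n. a (m r) * \<alpha> (m r) (k s)\<bar>)"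
        using a by (intro diagonal_dominance mk \<delta>) auto
      also have "\<dots> = sum_over (\<lambda>k. \<bar>?c k\<bar>) ?E"
        by (simp only: sum_map)
      also have "\<dots> \<le> list_norm H ?c"
        by (rule sum_over_le_list_norm[OF inj singletons incr conjunct2[OF A_lincomb] E_in])
      also have "\<dots> = vnorm ?V (A ?u)"
        using A_lincomb[of a "map m [0..<Suc n]"] by (simp only: V)
      also have "\<dots> \<le> K * vnorm X ?u"
        by (intro K lincomb_closed x)
      finally have "\<delta> / (2 * K) * sum_over a (map m [0..<Suc n]) \<le> vnorm X ?u"
        using K_pos unfolding sum_map by (simp add: field_simps del: sum.lessThan_Suc)
      moreover have "1 / real (Suc N) * sum_over a (map m [0..<Suc n]) \<le>
          \<delta> / (2 * K) * sum_over a (map m [0..<Suc n])"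
        using N a by (intro mult_right_mono sum_over_nonneg) auto
      ultimately show "1 / real (Suc N) * sum_over a (map m [0..<Suc n]) \<le> vnorm X ?u"
        by linarith
    qed
  qed
  then show False
    using l1_lists_no_branch[OF x null, of "1 / real (Suc N)"] by auto
qed

theorem theorem5:
  shows "\<not> (\<exists>(X :: 'u normed_structure) Z S. universal_for non_completely_continuous X Z S)"
proof
  assume "\<exists>(X :: 'u normed_structure) Z S. universal_for non_completely_continuous X Z S"
  then obtain X Z :: "'u normed_structure" and S where
    ncc: "non_completely_continuous X Z S" and
    univ: "\<And>V W U. non_completely_continuous V W U \<Longrightarrow> factors_through X Z S V W U"
    unfolding universal_for_def by blast
  interpret X: banach_space X
    using ncc by (simp add: non_completely_continuous_def)
  interpret Z: banach_space Z
    using ncc by (simp add: non_completely_continuous_def)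
  have S: "operator X Z S" and not_cc: "\<not> completely_continuous X Z S"
    using ncc by (auto simp: non_completely_continuous_def)
  obtain x :: "nat \<Rightarrow> 'u" and \<delta> where x: "range x \<subseteq> carrier X"
    and null: "\<And>f. operator X (type_space :: real normed_structure) f \<Longrightarrow> (\<lambda>n. f (x n)) \<longlonglongrightarrow> 0"
    and \<delta>: "0 < \<delta>" "\<And>n. \<delta> \<le> vnorm Z (S (x n))"
    by (rule not_completely_continuous_weakly_null[OF X.normed_vector_space_axioms
          Z.normed_vector_space_axioms S not_cc]) blast
  have x_in: "x n \<in> carrier X" for n
    using x by auto
  obtain \<iota> :: "(nat \<Rightarrow> real) \<Rightarrow> 'u" where inj: "inj \<iota>"
  proof -
    have "S \<zero>\<^bsub>X\<^esub> = \<zero>\<^bsub>Z\<^esub>"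
      by (rule operator_zero[OF X.normed_vector_space_axioms Z.normed_vector_space_axioms S])
    then have "x 0 \<noteq> \<zero>\<^bsub>X\<^esub>"
      using \<delta>(1) \<delta>(2)[of 0] Z.vnorm_eq_0[of "\<zero>\<^bsub>Z\<^esub>"] by auto
    then have nonzero: "vnorm X (x 0) \<noteq> 0"
      using X.vnorm_eq_0[OF x_in] by blast
    have "inj (\<lambda>t. t \<odot>\<^bsub>X\<^esub> x 0)"
    proof (rule injI)
      fix s t assume eq: "s \<odot>\<^bsub>X\<^esub> x 0 = t \<odot>\<^bsub>X\<^esub> x 0"
      have "(s + - t) \<odot>\<^bsub>X\<^esub> x 0 = (t + - t) \<odot>\<^bsub>X\<^esub> x 0"
        by (simp only: X.scale_add_left[OF x_in] eq)
      then have "\<bar>s - t\<bar> * vnorm X (x 0) = \<bar>t - t\<bar> * vnorm X (x 0)"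
        using X.vnorm_smult[OF x_in, of "s - t" 0] X.vnorm_smult[OF x_in, of "t - t" 0] by simp
      then show "s = t"
        using nonzero by simp
    qed
    moreover obtain g :: "(nat \<Rightarrow> real) \<Rightarrow> real" where "inj g"
      using inj_real_sequences_into_reals by blast
    ultimately show thesis
      using that inj_compose by blast
  qed
  \<comment> \<open>the test operator depends on \<open>X\<close> and \<open>x\<close>; the diagonal step covers all constants at once\<close>
  define G where "G N = X.l1_lists x (1 / real (Suc N))" for N
  define H where "H = diagonal_step (\<lambda>N. spreads (G N))"
  have singletons: "[n] \<in> H" for n
  proof -
    have "[] \<in> spreads (G 0)"
      by (simp add: spreads_def G_def X.l1_lists_def X.vnorm_nonneg)
    then show ?thesis
      by (auto simp: H_def diagonal_step_def)
  qed
  have incr: "increasing E" if "E \<in> H" for E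
    using that by (auto simp: H_def diagonal_step_def)
  have "negligible (spreads (G N))" for N
    unfolding G_def
    by (rule negligible_spreads[OF X.l1_lists_append[OF x] X.l1_lists_no_branch[OF x null]]) auto
  then have "negligible H"
    unfolding H_def by (rule negligible_diagonal_step)
  then have "factors_through X Z S (sequence_space \<iota> H) (sequence_space \<iota> singleton_lists) id"
    by (intro univ identity_into_sup_norm_non_completely_continuous inj singletons incr)
  then obtain A B where A: "operator X (sequence_space \<iota> H) A"
    and B: "operator (sequence_space \<iota> singleton_lists) Z B"
    and BA: "\<And>u. u \<in> carrier X \<Longrightarrow> B (A u) = S u"
    unfolding factors_through_def id_apply by blast
  let ?W = "sequence_space \<iota> singleton_lists"
  have sing: "[n] \<in> singleton_lists" "E \<in> singleton_lists \<Longrightarrow> increasing E" for n E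
    by auto
  obtain K where K: "\<And>w. w \<in> carrier ?W \<Longrightarrow> vnorm Z (B w) \<le> K * vnorm ?W w"
    using B unfolding operator_def by blast
  define \<epsilon> where "\<epsilon> = \<delta> / (2 * (\<bar>K\<bar> + 1))"
  have "0 < \<epsilon>"
    using \<delta>(1) by (simp add: \<epsilon>_def add_nonneg_pos)
  then obtain n where n: "\<And>k. \<bar>inv_into UNIV \<iota> (A (x n)) k\<bar> < \<epsilon>"
    using operator_image_uniformly_small_coordinates[OF X.normed_vector_space_axioms x null inj singletons incr
        H_def[unfolded G_def] A] by blast
  have "A (x n) \<in> \<iota> ` null_sequences H"
    using A x_in[of n] by (auto simp: operator_def sequence_space_simps(1)[OF inj singletons incr])
  then obtain a where a: "A (x n) = \<iota> a" "a \<in> null_sequences H"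
    by blast
  have a_small: "\<bar>a k\<bar> \<le> \<epsilon>" for k
    using n[of k] a(1) inj by simp
  have a_W: "a \<in> null_sequences singleton_lists"
    using a(2) a_small
    by (intro null_sequencesI[OF inj sing, of _ \<epsilon>]) (auto simp: null_sequences_def)
  have norm_a: "list_norm singleton_lists a \<le> \<epsilon>"
    by (rule list_norm_le[OF inj sing]) (use a_small in auto)
  have "\<delta> \<le> vnorm Z (B (\<iota> a))"
    using \<delta>(2)[of n] BA[OF x_in[of n]] a(1) by simp
  also have "\<dots> \<le> K * list_norm singleton_lists a"
    using K[of "\<iota> a"] a_W by (simp add: sequence_space_simps[OF inj sing])
  also have "\<dots> \<le> (\<bar>K\<bar> + 1) * list_norm singleton_lists a"
    using abs_le_list_norm[OF inj sing a_W, of 0] by (intro mult_right_mono) auto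
  also have "\<dots> \<le> (\<bar>K\<bar> + 1) * \<epsilon>"
    using norm_a by (intro mult_left_mono) auto
  also have "\<dots> = \<delta> / 2"
    by (simp add: \<epsilon>_def field_simps)
  finally show False
    using \<delta>(1) by simp
qed

end
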